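(* Given an arbitrary antenna pattern $g(\theta,\phi)$, a path loss model $l(\cdot)$, and the spatial distribution of drones $\lambda(\theta,\phi,\rho)$, the no-fly zone with minimum volume (that is, the solution of the constrained minimization problem described in the context) is constructed by the separation distance $r^*$ that satisfies $$P\,\lambda\bigl(\theta,\phi,r^*(\theta,\phi)\bigr)\,l\bigl(r^*(\theta,\phi)\bigr)\,g(\theta,\phi)=\mu,$$ where $\mu\in\mathbb{R}$ is the Lagrange multiplier (a constant, independent of $(\theta,\phi)$).
   Context: A ground station receives interference from drones. Use spherical coordinates $(\rho,\theta,\phi)$ centred at the ground station, with $\theta\in[0,\frac{\pi}{2}]$, $\phi\in[0,2\pi]$ and volume element $\rho^2\sin\theta\,d\rho\,d\theta\,d\phi$. Drones in the region $A=\{\rho\le R(\theta,\phi)\}$ (in the upper half-space) contribute to the interference, where $R(\theta,\phi)$ is the given distance from the ground station to the boundary of $A$. The drone locations form a Poisson point process with intensity $\lambda(\theta,\phi,\rho)$. The ground station's antenna gain is an arbitrary non-negative function $g(\theta,\phi)$. The path loss $l$ depends only on the distance between drone and ground station. The constant $P$ is the unwanted emission power of a drone, averaged over the resource blocks the drones use. The no-fly zone is a subset $B\subset A$ of the form $B=\{\rho\le r(\theta,\phi)\}$ (in the upper half-space), where $r(\theta,\phi)$ is the separation distance function. Excluding drones from $B$ reduces the expected interference at the ground station by $$\mathbb{E}[I_B]=\int_{0}^{2\pi}\int_{0}^{\pi/2}\int_{0}^{r(\theta,\phi)}P\,\lambda(\theta,\phi,\rho)\,l(\rho)\,g(\theta,\phi)\,\rho^2\sin\theta\,d\rho\,d\theta\,d\phi.$$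 The minimum-volume problem is to choose $r(\theta,\phi)$ to minimize the volume $$J[r]=\int_{0}^{2\pi}\int_{0}^{\pi/2}\int_{0}^{r(\theta,\phi)}\rho^2\sin\theta\,d\rho\,d\theta\,d\phi$$ subject to $\mathbb{E}[I_B]\ge a$. Here $a=\mathbb{E}[I_A]-a'$, where $\mathbb{E}[I_A]$ is the same integral with $r$ replaced by $R$ (the expected interference without a no-fly zone) and $a'$ is the regulatory limit on the mean interference. The Lagrange multiplier $\mu$ is the one associated with this interference constraint.
   Formalization: Proved as a necessary condition on a given minimizer: the equation holds for almost every (θ,φ) with 0<r*<R (it can fail where r*=0 or r*=R); λ is assumed continuous in ρ inside A, l continuous for ρ>0, data measurable, l and λ non-negative, and the volume of A and E[I_A] finite. *)

theory Defs
  imports "HOL-Analysis.Analysis"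
begin

text \<open>
  Spherical coordinates centred at the ground station: polar angle \<open>\<theta>\<close> in \<open>[0, \<pi>/2]\<close>,
  azimuth \<open>\<phi>\<close> in \<open>[0, 2\<pi>]\<close>, volume element \<open>\<rho>\<^sup>2 sin \<theta> d\<rho> d\<theta> d\<phi>\<close>.
  Functions on the hemisphere take their arguments in the order \<open>\<theta>\<close>, \<open>\<phi>\<close>.
\<close>

definition hemisphere :: "(real \<times> real) set" where
  "hemisphere = {0..pi/2} \<times> {0..2*pi}"

definition region :: "(real \<Rightarrow> real \<Rightarrow> real) \<Rightarrow> (real \<times> real \<times> real) set" where
  "region r = {(\<theta>, \<phi>, \<rho>). (\<theta>, \<phi>) \<in> hemisphere \<and> 0 \<le> \<rho> \<and> \<rho> \<le> r \<theta> \<phi>}"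

definition volume :: "(real \<Rightarrow> real \<Rightarrow> real) \<Rightarrow> real" where
  "volume r =
     (LBINT \<phi>=0..2*pi. (LBINT \<theta>=0..pi/2. (LBINT \<rho>=0..r \<theta> \<phi>. \<rho>\<^sup>2 * sin \<theta>)))"

definition expected_interference ::
  "real \<Rightarrow> (real \<Rightarrow> real \<Rightarrow> real \<Rightarrow> real) \<Rightarrow> (real \<Rightarrow> real) \<Rightarrow> (real \<Rightarrow> real \<Rightarrow> real)
    \<Rightarrow> (real \<Rightarrow> real \<Rightarrow> real) \<Rightarrow> real" where
  "expected_interference P lam l g r =
     (LBINT \<phi>=0..2*pi. (LBINT \<theta>=0..pi/2. (LBINT \<rho>=0..r \<theta> \<phi>.
        P * lam \<theta> \<phi> \<rho> * l \<rho> * g \<theta> \<phi> * \<rho>\<^sup>2 * sin \<theta>)))"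

text \<open>Separation distances \<open>r\<close> for which the no-fly zone is a (measurable) subset of
  \<open>region R\<close>.\<close>

definition admissible :: "(real \<Rightarrow> real \<Rightarrow> real) \<Rightarrow> (real \<Rightarrow> real \<Rightarrow> real) \<Rightarrow> bool" where
  "admissible R r \<longleftrightarrow>
     set_borel_measurable borel hemisphere (\<lambda>(\<theta>, \<phi>). r \<theta> \<phi>) \<and>
     (\<forall>(\<theta>, \<phi>) \<in> hemisphere. 0 \<le> r \<theta> \<phi> \<and> r \<theta> \<phi> \<le> R \<theta> \<phi>)"

definition min_volume_solution ::
  "real \<Rightarrow> (real \<Rightarrow> real \<Rightarrow> real \<Rightarrow> real) \<Rightarrow> (real \<Rightarrow> real) \<Rightarrow> (real \<Rightarrow> real \<Rightarrow> real)
    \<Rightarrow> (real \<Rightarrow> real \<Rightarrow> real) \<Rightarrow> real \<Rightarrow> (real \<Rightarrow> real \<Rightarrow> real) \<Rightarrow> bool" where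
  "min_volume_solution P lam l g R a r \<longleftrightarrow>
     is_arg_min volume (\<lambda>s. admissible R s \<and> expected_interference P lam l g s \<ge> a) r"

text \<open>
  The multiplier is normalised so that it multiplies the volume. For \<open>\<mu> \<noteq> 0\<close> this is
  \<open>- \<mu>\<close> times the Lagrangian \<open>J - \<nu> (E - a)\<close> with \<open>\<nu> = 1 / \<mu>\<close>. The pointwise stationarity
  condition of \<open>E - a - \<mu> J\<close> is \<open>(P \<lambda> l g - \<mu>) \<rho>\<^sup>2 sin \<theta> = 0\<close> at \<open>\<rho> = r(\<theta>, \<phi>)\<close>.
\<close>

definition lagrangian ::
  "real \<Rightarrow> (real \<Rightarrow> real \<Rightarrow> real \<Rightarrow> real) \<Rightarrow> (real \<Rightarrow> real) \<Rightarrow> (real \<Rightarrow> real \<Rightarrow> real)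
    \<Rightarrow> real \<Rightarrow> real \<Rightarrow> (real \<Rightarrow> real \<Rightarrow> real) \<Rightarrow> real" where
  "lagrangian P lam l g a \<mu> r = (expected_interference P lam l g r - a) - \<mu> * volume r"

text \<open>
  \<open>\<mu>\<close> is a Lagrange multiplier at \<open>r\<close> if the first variation of the Lagrangian vanishes at \<open>r\<close>
  in every two-sided admissible direction in which it exists. (The integrand may be unbounded,
  so it need not exist in all of them.)
\<close>

definition lagrange_multiplier ::
  "real \<Rightarrow> (real \<Rightarrow> real \<Rightarrow> real \<Rightarrow> real) \<Rightarrow> (real \<Rightarrow> real) \<Rightarrow> (real \<Rightarrow> real \<Rightarrow> real)
    \<Rightarrow> (real \<Rightarrow> real \<Rightarrow> real) \<Rightarrow> real \<Rightarrow> (real \<Rightarrow> real \<Rightarrow> real) \<Rightarrow> real \<Rightarrow> bool" where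
  "lagrange_multiplier P lam l g R a r \<mu> \<longleftrightarrow>
     (\<forall>h D. (\<forall>\<^sub>F \<epsilon> in at 0. admissible R (\<lambda>\<theta> \<phi>. r \<theta> \<phi> + \<epsilon> * h \<theta> \<phi>)) \<longrightarrow>
        ((\<lambda>\<epsilon>. lagrangian P lam l g a \<mu> (\<lambda>\<theta> \<phi>. r \<theta> \<phi> + \<epsilon> * h \<theta> \<phi>))
           has_real_derivative D) (at 0) \<longrightarrow>
        D = 0)"

end

theory Submission
  imports Defs
begin

text \<open>
  Write \<open>f = P \<lambda> l g\<close>. If \<open>f\<close> at the boundary of the optimal zone were below \<open>\<alpha>\<close> on a set of positive
  measure and above \<open>\<beta> > \<alpha>\<close> on another one, then, \<open>f\<close> being continuous in \<open>\<rho>\<close>, these bounds would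
  hold uniformly near the boundary over smaller sets of positive measure. Receding over the first
  set and advancing over the second would remove more interference with less volume. Hence \<open>f\<close>
  equals a constant \<open>\<mu>\<close> almost everywhere on the free part of the boundary, and an exchange of the
  same kind shows that the Lagrangian has no nonzero derivative along any two-sided direction.
\<close>

subsection \<open>Integration in spherical coordinates\<close>

text \<open>The density \<open>f\<close> is continuous along each ray, but with no uniformity in the
  angles, and it may be unbounded. The interference of a varied zone therefore need not be
  differentiable. The volume, by contrast, is a cubic polynomial in the size of the variation. So
  first-order information is taken from the volume, and interference enters through one-sided
  estimates: its change is at least \<open>m\<close> times the change of volume, when
  \<open>m\<close> bounds \<open>f\<close> suitably between the two boundaries. A competitor is
  contradictory as soon as it has less volume and no less interference than \<open>r\<close>, so
  binding and slack constraints are treated alike. The missing uniformity in the angles comes from a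
  countable exhaustion: the relevant free points are covered, up to a null set, by countably many
  measurable sets with explicit margins, and one of these is not null.\<close>

lemma hemisphere_borel [measurable]: "hemisphere \<in> sets borel"
  unfolding hemisphere_def by (simp add: borel_closed closed_Times)

lemma borel_measurable_assoc:
  "(\<lambda>z::(real \<times> real) \<times> real. (fst (fst z), snd (fst z), snd z)) \<in> borel \<rightarrow>\<^sub>M borel"
  by (intro borel_measurable_continuous_onI continuous_intros)

text \<open>\<open>region\<close> consists of triples nested to the right, whereas radial
  integration needs both angles grouped as one variable. Iterating Tonelli on either side gives the
  same triple integral.\<close>

lemma nn_integral_assoc:
  fixes u :: "real \<times> real \<times> real \<Rightarrow> ennreal"
  assumes [measurable]: "u \<in> borel_measurable borel"
  shows "(\<integral>\<^sup>+z. u (fst (fst z), snd (fst z), snd z) \<partial>lborel) = (\<integral>\<^sup>+z. u z \<partial>lborel)"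
proof -
  have m [measurable]: "(\<lambda>z. u (fst (fst z), snd (fst z), snd z)) \<in> borel_measurable borel"
    using measurable_comp[OF borel_measurable_assoc assms] by (simp add: comp_def)
  have "(\<integral>\<^sup>+z. u (fst (fst z), snd (fst z), snd z) \<partial>lborel)
      = (\<integral>\<^sup>+x. \<integral>\<^sup>+\<rho>. u (fst x, snd x, \<rho>) \<partial>lborel \<partial>(lborel \<Otimes>\<^sub>M lborel))"
    using lborel.nn_integral_fst[of "\<lambda>z. u (fst (fst z), snd (fst z), snd z)" "lborel \<Otimes>\<^sub>M lborel"]
      m by (simp add: lborel_prod)
  also have "\<dots> = (\<integral>\<^sup>+\<theta>. \<integral>\<^sup>+\<phi>. \<integral>\<^sup>+\<rho>. u (\<theta>, \<phi>, \<rho>) \<partial>lborel \<partial>lborel \<partial>lborel)"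
  proof -
    have "(\<lambda>x. \<integral>\<^sup>+\<rho>. u (fst x, snd x, \<rho>) \<partial>lborel) \<in> borel_measurable (lborel \<Otimes>\<^sub>M lborel)"
      using lborel.borel_measurable_nn_integral_fst[of "\<lambda>z. u (fst (fst z), snd (fst z), snd z)" "lborel \<Otimes>\<^sub>M lborel"] m
      by (simp add: lborel_prod)
    from lborel.nn_integral_fst[OF this] show ?thesis by simp
  qed
  also have "\<dots> = (\<integral>\<^sup>+\<theta>. \<integral>\<^sup>+y. u (\<theta>, y) \<partial>(lborel \<Otimes>\<^sub>M lborel) \<partial>lborel)"
  proof (intro nn_integral_cong)
    fix \<theta> :: real
    have "(\<lambda>y. u (\<theta>, y)) \<in> borel_measurable (lborel \<Otimes>\<^sub>M lborel)"
      unfolding lborel_prod by measurable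
    from lborel.nn_integral_fst[OF this]
    show "(\<integral>\<^sup>+\<phi>. \<integral>\<^sup>+\<rho>. u (\<theta>, \<phi>, \<rho>) \<partial>lborel \<partial>lborel) = (\<integral>\<^sup>+y. u (\<theta>, y) \<partial>(lborel \<Otimes>\<^sub>M lborel))" .
  qed
  also have "\<dots> = (\<integral>\<^sup>+z. u z \<partial>lborel)"
    using lborel.nn_integral_fst[of u lborel] by (simp add: lborel_prod)
  finally show ?thesis .
qed

lemma integrable_assoc:
  fixes u :: "real \<times> real \<times> real \<Rightarrow> real"
  assumes "integrable lborel u"
  shows "integrable (lborel \<Otimes>\<^sub>M lborel) (\<lambda>((\<theta>, \<phi>), \<rho>). u (\<theta>, \<phi>, \<rho>))"
proof -
  have [measurable]: "u \<in> borel_measurable borel"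
    using borel_measurable_integrable[OF assms] by simp
  have "(\<lambda>z. u (fst (fst z), snd (fst z), snd z)) \<in> borel_measurable borel"
    using measurable_comp[OF borel_measurable_assoc, of u] by (simp add: comp_def)
  then show ?thesis
    using assms nn_integral_assoc[of "\<lambda>z. ennreal (norm (u z))"]
    by (auto simp: integrable_iff_bounded lborel_prod case_prod_unfold)
qed

lemma region_borel:
  assumes "set_borel_measurable borel hemisphere (\<lambda>(\<theta>, \<phi>). s \<theta> \<phi>)"
  shows "region s \<in> sets borel"
proof -
  define s' where "s' = (\<lambda>x. indicator hemisphere x *\<^sub>R (case x of (\<theta>, \<phi>) \<Rightarrow> s \<theta> \<phi>))"
  have [measurable]: "s' \<in> borel_measurable borel"
    using assms unfolding s'_def set_borel_measurable_def .
  have [measurable]: "(\<lambda>z::real \<times> real \<times> real. (fst z, fst (snd z))) \<in> borel \<rightarrow>\<^sub>M borel"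
    by (intro borel_measurable_continuous_onI continuous_intros)
  have [measurable]: "(\<lambda>z::real \<times> real \<times> real. snd (snd z)) \<in> borel \<rightarrow>\<^sub>M borel"
    by (intro borel_measurable_continuous_onI continuous_intros)
  have "region s = {z \<in> space borel. (fst z, fst (snd z)) \<in> hemisphere \<and> 0 \<le> snd (snd z)
      \<and> snd (snd z) \<le> s' (fst z, fst (snd z))}"
    by (auto simp: region_def s'_def)
  also have "\<dots> \<in> sets borel" by measurable
  finally show ?thesis .
qed

text \<open>Radial integral over one direction, extended by zero off the hemisphere, so that zones
  can be compared as functions on the plane of angles.\<close>

definition shell :: "(real \<Rightarrow> real \<Rightarrow> real \<Rightarrow> real) \<Rightarrow> (real \<Rightarrow> real \<Rightarrow> real) \<Rightarrow> real \<times> real \<Rightarrow> real" where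
  "shell K s x = indicator hemisphere x * (LBINT \<rho>:{0..s (fst x) (snd x)}. K (fst x) (snd x) \<rho>)"

text \<open>All three are instances of Fubini on the regrouped product. The third is what permits
  comparing radial integrals: without integrability a Bochner integral is \<open>0\<close> by
  convention, and inequalities between integrands would say nothing.\<close>

lemma
  assumes int: "set_integrable lborel (region s) (\<lambda>(\<theta>, \<phi>, \<rho>). K \<theta> \<phi> \<rho>)"
    and nonneg: "\<And>\<theta> \<phi>. (\<theta>, \<phi>) \<in> hemisphere \<Longrightarrow> 0 \<le> s \<theta> \<phi>"
  shows integrable_shell: "integrable lborel (shell K s)"
    and iterated_integral_shell:
      "(LBINT \<phi>=0..2*pi. (LBINT \<theta>=0..pi/2. (LBINT \<rho>=0..s \<theta> \<phi>. K \<theta> \<phi> \<rho>)))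
        = (LBINT x. shell K s x)"
    and AE_set_integrable_radial:
      "AE x in lborel. x \<in> hemisphere \<longrightarrow> set_integrable lborel {0..s (fst x) (snd x)} (K (fst x) (snd x))"
proof -
  define u where "u = (\<lambda>z. indicator (region s) z *\<^sub>R (case z of (\<theta>, \<phi>, \<rho>) \<Rightarrow> K \<theta> \<phi> \<rho>))"
  have u: "integrable lborel u" using int unfolding u_def set_integrable_def .
  note iu = integrable_assoc[OF u]
  have ueq: "u (\<theta>, \<phi>, \<rho>) = indicator hemisphere (\<theta>, \<phi>) * (indicator {0..s \<theta> \<phi>} \<rho> *\<^sub>R K \<theta> \<phi> \<rho>)" for \<theta> \<phi> \<rho>
    by (auto simp: u_def region_def indicator_def)
  have sh: "(LBINT \<rho>. u (fst x, snd x, \<rho>)) = shell K s x" for x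
    by (simp add: ueq shell_def set_lebesgue_integral_def)
  show ish: "integrable lborel (shell K s)"
    using lborel_pair.integrable_fst'[OF iu] by (simp add: case_prod_unfold sh)
  have "AE x in lborel. integrable lborel (\<lambda>\<rho>. u (fst x, snd x, \<rho>))"
    using lborel_pair.AE_integrable_fst'[OF iu] by (simp add: case_prod_unfold)
  then show "AE x in lborel. x \<in> hemisphere \<longrightarrow> set_integrable lborel {0..s (fst x) (snd x)} (K (fst x) (snd x))"
    by eventually_elim (auto simp: ueq set_integrable_def)
  have "(LBINT \<phi>=0..2*pi. (LBINT \<theta>=0..pi/2. (LBINT \<rho>=0..s \<theta> \<phi>. K \<theta> \<phi> \<rho>)))
      = (LBINT \<phi>:{0..2*pi}. LBINT \<theta>:{0..pi/2}. LBINT \<rho>:{0..s \<theta> \<phi>}. K \<theta> \<phi> \<rho>)"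
  proof -
    have Icc: "interval_lebesgue_integral lborel 0 (ereal b) v = (LBINT t:{0..b}. v t)"
      if "0 \<le> b" for b and v :: "real \<Rightarrow> real"
      using interval_integral_Icc[OF that] by (simp add: zero_ereal_def)
    have "(LBINT \<phi>=0..2*pi. (LBINT \<theta>=0..pi/2. (LBINT \<rho>=0..s \<theta> \<phi>. K \<theta> \<phi> \<rho>))) =
       (LBINT \<phi>:{0..2*pi}. (LBINT \<theta>:{0..pi/2}. (LBINT \<rho>=0..s \<theta> \<phi>. K \<theta> \<phi> \<rho>)))"
      by (simp add: Icc)
    also have "\<dots> = (LBINT \<phi>:{0..2*pi}. LBINT \<theta>:{0..pi/2}. LBINT \<rho>:{0..s \<theta> \<phi>}. K \<theta> \<phi> \<rho>)"
      using nonneg by (intro set_lebesgue_integral_cong allI impI) (auto simp: Icc hemisphere_def)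
    finally show ?thesis .
  qed
  also have "\<dots> = (LBINT \<phi>. LBINT \<theta>. shell K s (\<theta>, \<phi>))"
    unfolding set_lebesgue_integral_def shell_def hemisphere_def
    by (auto intro!: Bochner_Integration.integral_cong simp: indicator_times mult.assoc simp flip: integral_mult_right_zero)
  also have "\<dots> = (LBINT x. shell K s x)"
    using lborel_pair.integral_snd[of "\<lambda>x y. shell K s (x, y)"] ish by (simp add: lborel_prod)
  finally show "(LBINT \<phi>=0..2*pi. (LBINT \<theta>=0..pi/2. (LBINT \<rho>=0..s \<theta> \<phi>. K \<theta> \<phi> \<rho>)))
        = (LBINT x. shell K s x)" .
qed

lemma hemisphere_sin_nonneg: "x \<in> hemisphere \<Longrightarrow> 0 \<le> sin (fst x)"
  by (auto simp: hemisphere_def intro!: sin_ge_zero)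

text \<open>The volume element degenerates at \<open>\<theta> = 0\<close>, which is a null line in
  the plane of angles.\<close>

lemma AE_hemisphere_sin_pos: "AE x in lborel. x \<in> hemisphere \<longrightarrow> 0 < sin (fst x)"
proof -
  have "{0} \<times> UNIV \<in> null_sets (lborel \<Otimes>\<^sub>M lborel :: (real \<times> real) measure)"
    by (simp add: null_sets_def lborel.emeasure_pair_measure_Times)
  then have "AE x in lborel. x \<notin> {0::real} \<times> (UNIV :: real set)"
    unfolding lborel_prod by (rule AE_not_in)
  then show ?thesis
  proof eventually_elim
    case (elim x)
    show ?case
    proof
      assume "x \<in> hemisphere"
      then have "0 \<le> fst x" "fst x \<le> pi/2" by (auto simp: hemisphere_def)
      moreover have "fst x \<noteq> 0" using elim by (cases x) auto
      ultimately show "0 < sin (fst x)" using pi_gt_zero by (intro sin_gt_zero) linarith+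
    qed
  qed
qed

lemma admissible_eq:
  "admissible R s \<longleftrightarrow> (\<lambda>x. indicator hemisphere x * s (fst x) (snd x)) \<in> borel_measurable borel \<and>
     (\<forall>x\<in>hemisphere. 0 \<le> s (fst x) (snd x) \<and> s (fst x) (snd x) \<le> R (fst x) (snd x))"
  by (auto simp: admissible_def set_borel_measurable_def case_prod_unfold)

text \<open>Moving the endpoint from \<open>s\<close> to \<open>s'\<close> adds only radii where
  \<open>k - m * p\<close> is nonnegative, or removes only radii where it is nonpositive. Either way
  its integral does not decrease, so both orders of the endpoints are covered at once. The endpoints
  themselves, where nothing is assumed, are null.\<close>

lemma set_lebesgue_integral_radial_diff_ge:
  fixes k p :: "real \<Rightarrow> real"
  assumes k: "set_integrable lborel {0..c} k" and p: "set_integrable lborel {0..c} p"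
    and "0 \<le> s" "s \<le> c" "0 \<le> s'" "s' \<le> c"
    and up: "\<And>\<rho>. s < \<rho> \<Longrightarrow> \<rho> < s' \<Longrightarrow> m * p \<rho> \<le> k \<rho>"
    and down: "\<And>\<rho>. s' < \<rho> \<Longrightarrow> \<rho> < s \<Longrightarrow> k \<rho> \<le> m * p \<rho>"
  shows "m * ((LBINT \<rho>:{0..s'}. p \<rho>) - (LBINT \<rho>:{0..s}. p \<rho>)) \<le> (LBINT \<rho>:{0..s'}. k \<rho>) - (LBINT \<rho>:{0..s}. k \<rho>)"
proof -
  have si: "set_integrable lborel {0..t} k" "set_integrable lborel {0..t} p" if "t \<le> c" for t
    using that by (auto intro: set_integrable_subset[OF k] set_integrable_subset[OF p])
  have kp: "set_integrable lborel {0..t} (\<lambda>\<rho>. k \<rho> - m * p \<rho>)" if "t \<le> c" for t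
    using si[OF that] by simp
  have "(LBINT \<rho>:{0..s}. k \<rho> - m * p \<rho>) \<le> (LBINT \<rho>:{0..s'}. k \<rho> - m * p \<rho>)"
    unfolding set_lebesgue_integral_def
  proof (rule integral_mono_AE)
    show "integrable lborel (\<lambda>\<rho>. indicat_real {0..s} \<rho> *\<^sub>R (k \<rho> - m * p \<rho>))"
      "integrable lborel (\<lambda>\<rho>. indicat_real {0..s'} \<rho> *\<^sub>R (k \<rho> - m * p \<rho>))"
      using kp assms(3-6) unfolding set_integrable_def by auto
    have "AE \<rho> in lborel. \<rho> \<noteq> s" "AE \<rho> in lborel. \<rho> \<noteq> s'" by (rule AE_lborel_singleton)+
    then show "AE \<rho> in lborel. indicat_real {0..s} \<rho> *\<^sub>R (k \<rho> - m * p \<rho>) \<le> indicat_real {0..s'} \<rho> *\<^sub>R (k \<rho> - m * p \<rho>)"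
      by eventually_elim (use up down in \<open>auto simp: indicator_def\<close>)
  qed
  then show ?thesis using si assms(3-6) by (simp add: algebra_simps)
qed

subsection \<open>Volume and interference of a no-fly zone\<close>

locale no_fly_zone =
  fixes f :: "real \<Rightarrow> real \<Rightarrow> real \<Rightarrow> real"
    and R :: "real \<Rightarrow> real \<Rightarrow> real"
  assumes f_meas: "set_borel_measurable borel (region R) (\<lambda>(\<theta>, \<phi>, \<rho>). f \<theta> \<phi> \<rho>)"
    and f_nonneg: "\<And>\<theta> \<phi> \<rho>. (\<theta>, \<phi>, \<rho>) \<in> region R \<Longrightarrow> f \<theta> \<phi> \<rho> \<ge> 0"
    and f_cont: "\<And>\<theta> \<phi>. (\<theta>, \<phi>) \<in> hemisphere \<Longrightarrow> continuous_on {0<..<R \<theta> \<phi>} (f \<theta> \<phi>)"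
    and R_nonneg: "\<And>\<theta> \<phi>. (\<theta>, \<phi>) \<in> hemisphere \<Longrightarrow> R \<theta> \<phi> \<ge> 0"
    and R_meas: "set_borel_measurable borel hemisphere (\<lambda>(\<theta>, \<phi>). R \<theta> \<phi>)"
    and finite_volume:
      "set_integrable lborel (region R) (\<lambda>(\<theta>, \<phi>, \<rho>). \<rho>\<^sup>2 * sin \<theta>)"
    and finite_interference:
      "set_integrable lborel (region R) (\<lambda>(\<theta>, \<phi>, \<rho>). f \<theta> \<phi> \<rho> * \<rho>\<^sup>2 * sin \<theta>)"
begin

definition interference :: "(real \<Rightarrow> real \<Rightarrow> real) \<Rightarrow> real" where
  "interference s =
     (LBINT \<phi>=0..2*pi. (LBINT \<theta>=0..pi/2. (LBINT \<rho>=0..s \<theta> \<phi>. f \<theta> \<phi> \<rho> * \<rho>\<^sup>2 * sin \<theta>)))"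

lemma admissible_meas:
  "admissible R s \<Longrightarrow> (\<lambda>x. indicator hemisphere x * s (fst x) (snd x)) \<in> borel_measurable borel"
  by (simp add: admissible_eq)

lemma admissible_bounds:
  "admissible R s \<Longrightarrow> (\<theta>, \<phi>) \<in> hemisphere \<Longrightarrow> 0 \<le> s \<theta> \<phi> \<and> s \<theta> \<phi> \<le> R \<theta> \<phi>"
  by (auto simp: admissible_def)

lemma admissible_subregion:
  assumes "admissible R s" and "set_integrable lborel (region R) (\<lambda>(\<theta>, \<phi>, \<rho>). K \<theta> \<phi> \<rho>)"
  shows "set_integrable lborel (region s) (\<lambda>(\<theta>, \<phi>, \<rho>). K \<theta> \<phi> \<rho> :: real)"
proof (rule set_integrable_subset[OF assms(2)])
  show "region s \<in> sets lborel"
    using assms(1) by (simp add: admissible_def region_borel)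
  show "region s \<subseteq> region R"
    using assms(1) by (fastforce simp: admissible_def region_def)
qed

lemma admissible_R: "admissible R R"
  using R_nonneg R_meas by (auto simp: admissible_def)

abbreviation vol_shell where "vol_shell \<equiv> shell (\<lambda>\<theta> \<phi> \<rho>. \<rho>\<^sup>2 * sin \<theta>)"
abbreviation int_shell where "int_shell \<equiv> shell (\<lambda>\<theta> \<phi> \<rho>. f \<theta> \<phi> \<rho> * \<rho>\<^sup>2 * sin \<theta>)"

text \<open>This closed form is the source of the cubic dependence of the volume on a
  variation.\<close>

lemma vol_shell:
  assumes "admissible R s"
  shows "vol_shell s x = indicator hemisphere x * (sin (fst x) * s (fst x) (snd x) ^ 3 / 3)"
proof (cases "x \<in> hemisphere")
  case True
  then have "0 \<le> s (fst x) (snd x)" using admissible_bounds[OF assms, of "fst x" "snd x"] by simp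
  from integral_power[OF this, of 2] show ?thesis
    using True
    by (simp add: shell_def set_lebesgue_integral_def numeral_3_eq_3 mult.commute)
qed (simp add: shell_def)

lemma volume_eq:
  assumes "admissible R s"
  shows "volume s = (LBINT x. vol_shell s x)" and "integrable lborel (vol_shell s)"
  using iterated_integral_shell[of s "\<lambda>\<theta> \<phi> \<rho>. \<rho>\<^sup>2 * sin \<theta>"] integrable_shell[of s "\<lambda>\<theta> \<phi> \<rho>. \<rho>\<^sup>2 * sin \<theta>"]
    admissible_subregion[OF assms finite_volume] admissible_bounds[OF assms]
  by (simp_all add: volume_def)

lemma interference_eq:
  assumes "admissible R s"
  shows "interference s = (LBINT x. int_shell s x)" and "integrable lborel (int_shell s)"
  using iterated_integral_shell[of s "\<lambda>\<theta> \<phi> \<rho>. f \<theta> \<phi> \<rho> * \<rho>\<^sup>2 * sin \<theta>"]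
    integrable_shell[of s "\<lambda>\<theta> \<phi> \<rho>. f \<theta> \<phi> \<rho> * \<rho>\<^sup>2 * sin \<theta>"]
    admissible_subregion[OF assms finite_interference] admissible_bounds[OF assms]
  by (simp_all add: interference_def)

text \<open>Advancing gains at least \<open>m\<close> units of interference per unit of volume, and
  receding loses at most \<open>m\<close>. Integrating the radial estimate over the angles therefore
  gives one inequality for zones that advance in some directions and recede in others.\<close>

lemma interference_diff_ge:
  assumes s: "admissible R s" and s': "admissible R s'"
    and up: "\<And>\<theta> \<phi> \<rho>. (\<theta>, \<phi>) \<in> hemisphere \<Longrightarrow> s \<theta> \<phi> < \<rho> \<Longrightarrow> \<rho> < s' \<theta> \<phi> \<Longrightarrow> m \<le> f \<theta> \<phi> \<rho>"
    and down: "\<And>\<theta> \<phi> \<rho>. (\<theta>, \<phi>) \<in> hemisphere \<Longrightarrow> s' \<theta> \<phi> < \<rho> \<Longrightarrow> \<rho> < s \<theta> \<phi> \<Longrightarrow> f \<theta> \<phi> \<rho> \<le> m"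
  shows "m * (volume s' - volume s) \<le> interference s' - interference s"
proof -
  note iv = volume_eq[OF s] volume_eq[OF s'] interference_eq[OF s] interference_eq[OF s']
  have "(LBINT x. m * (vol_shell s' x - vol_shell s x)) \<le> (LBINT x. int_shell s' x - int_shell s x)"
  proof (rule integral_mono_AE)
    show "integrable lborel (\<lambda>x. m * (vol_shell s' x - vol_shell s x))"
      "integrable lborel (\<lambda>x. int_shell s' x - int_shell s x)" using iv by auto
    have "AE x in lborel. x \<in> hemisphere \<longrightarrow> set_integrable lborel {0..R (fst x) (snd x)} (\<lambda>\<rho>. \<rho>\<^sup>2 * sin (fst x))"
      using AE_set_integrable_radial[OF finite_volume] R_nonneg by simp
    moreover have "AE x in lborel. x \<in> hemisphere \<longrightarrow> set_integrable lborel {0..R (fst x) (snd x)}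
        (\<lambda>\<rho>. f (fst x) (snd x) \<rho> * \<rho>\<^sup>2 * sin (fst x))"
      using AE_set_integrable_radial[OF finite_interference] R_nonneg by simp
    ultimately show "AE x in lborel. m * (vol_shell s' x - vol_shell s x) \<le> int_shell s' x - int_shell s x"
    proof eventually_elim
      case (elim x)
      show ?case
      proof (cases "x \<in> hemisphere")
        case True
        obtain \<theta> \<phi> where x: "x = (\<theta>, \<phi>)" by (cases x)
        have h: "(\<theta>, \<phi>) \<in> hemisphere" using True x by simp
        have w: "0 \<le> \<rho>\<^sup>2 * sin \<theta>" for \<rho> using hemisphere_sin_nonneg[OF h] by simp
        have "m * ((LBINT \<rho>:{0..s' \<theta> \<phi>}. \<rho>\<^sup>2 * sin \<theta>) - (LBINT \<rho>:{0..s \<theta> \<phi>}. \<rho>\<^sup>2 * sin \<theta>))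
          \<le> (LBINT \<rho>:{0..s' \<theta> \<phi>}. f \<theta> \<phi> \<rho> * \<rho>\<^sup>2 * sin \<theta>) - (LBINT \<rho>:{0..s \<theta> \<phi>}. f \<theta> \<phi> \<rho> * \<rho>\<^sup>2 * sin \<theta>)"
        proof (rule set_lebesgue_integral_radial_diff_ge[where c = "R \<theta> \<phi>"])
          show "m * (\<rho>\<^sup>2 * sin \<theta>) \<le> f \<theta> \<phi> \<rho> * \<rho>\<^sup>2 * sin \<theta>" if "s \<theta> \<phi> < \<rho>" "\<rho> < s' \<theta> \<phi>" for \<rho>
            using mult_right_mono[OF up[OF h that] w[of \<rho>]] by (simp add: mult.assoc)
          show "f \<theta> \<phi> \<rho> * \<rho>\<^sup>2 * sin \<theta> \<le> m * (\<rho>\<^sup>2 * sin \<theta>)" if "s' \<theta> \<phi> < \<rho>" "\<rho> < s \<theta> \<phi>" for \<rho>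
            using mult_right_mono[OF down[OF h that] w[of \<rho>]] by (simp add: mult.assoc)
        qed (use elim h x admissible_bounds[OF s h] admissible_bounds[OF s' h] in auto)
        then show ?thesis using h by (simp add: shell_def x)
      qed (simp add: shell_def)
    qed
  qed
  then show ?thesis using iv by simp
qed

end

subsection \<open>Variations of a minimal no-fly zone\<close>

locale minimal_no_fly_zone = no_fly_zone +
  fixes r :: "real \<Rightarrow> real \<Rightarrow> real" and a :: real
  assumes minimal: "is_arg_min volume (\<lambda>s. admissible R s \<and> a \<le> interference s) r"
begin

lemma admissible_r: "admissible R r" and r_feasible: "a \<le> interference r"
  and r_minimal: "admissible R s \<Longrightarrow> a \<le> interference s \<Longrightarrow> volume r \<le> volume s"
  using minimal by (auto simp: is_arg_min_def not_less)

definition perturb :: "(real \<Rightarrow> real \<Rightarrow> real) \<Rightarrow> real \<Rightarrow> real \<Rightarrow> real \<Rightarrow> real" where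
  "perturb h \<epsilon> = (\<lambda>\<theta> \<phi>. r \<theta> \<phi> + \<epsilon> * h \<theta> \<phi>)"

text \<open>Testing the two ends suffices. The bounds are convex and the difference of the ends
  makes \<open>h\<close> measurable on the hemisphere, so the whole segment is admissible
  (\<open>admissible_perturb\<close>). The ends also give \<open>e * \<bar>h\<bar> \<le> r\<close>,
  which dominates \<open>h\<close> by \<open>r\<close>.\<close>

definition two_sided :: "(real \<Rightarrow> real \<Rightarrow> real) \<Rightarrow> real \<Rightarrow> bool" where
  "two_sided h e \<longleftrightarrow> 0 < e \<and> admissible R (perturb h e) \<and> admissible R (perturb h (- e))"

text \<open>The first variation of the volume.\<close>

definition flux_density :: "(real \<Rightarrow> real \<Rightarrow> real) \<Rightarrow> real \<times> real \<Rightarrow> real" where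
  "flux_density h x = indicator hemisphere x * (sin (fst x) * (r (fst x) (snd x))\<^sup>2 * h (fst x) (snd x))"

definition flux :: "(real \<Rightarrow> real \<Rightarrow> real) \<Rightarrow> real" where
  "flux h = (LBINT x. flux_density h x)"

lemma perturb_0 [simp]: "perturb h 0 = r"
  by (simp add: perturb_def)

lemma perturb_zero [simp]: "perturb (\<lambda>\<theta> \<phi>. 0) \<epsilon> = r"
  by (simp add: perturb_def)

lemma two_sided_bounds:
  assumes "two_sided h e" "(\<theta>, \<phi>) \<in> hemisphere"
  shows "e * \<bar>h \<theta> \<phi>\<bar> \<le> r \<theta> \<phi>" "r \<theta> \<phi> + e * \<bar>h \<theta> \<phi>\<bar> \<le> R \<theta> \<phi>"
  using admissible_bounds[of "perturb h e" \<theta> \<phi>] admissible_bounds[of "perturb h (- e)" \<theta> \<phi>] assms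
  by (auto simp: two_sided_def perturb_def abs_if)

lemma r_meas: "(\<lambda>x. indicator hemisphere x * r (fst x) (snd x)) \<in> borel_measurable borel"
  by (rule admissible_meas[OF admissible_r])

lemma two_sided_meas:
  assumes "two_sided h e"
  shows "(\<lambda>x. indicator hemisphere x * h (fst x) (snd x)) \<in> borel_measurable borel"
proof -
  have "(\<lambda>x. (indicator hemisphere x * perturb h e (fst x) (snd x)
      - indicator hemisphere x * perturb h (- e) (fst x) (snd x)) / (2 * e)) \<in> borel_measurable borel"
    using assms by (intro borel_measurable_divide borel_measurable_diff admissible_meas)
      (auto simp: two_sided_def)
  moreover have "(\<lambda>x. (indicator hemisphere x * perturb h e (fst x) (snd x)
      - indicator hemisphere x * perturb h (- e) (fst x) (snd x)) / (2 * e))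
      = (\<lambda>x. indicator hemisphere x * h (fst x) (snd x))"
    using assms by (auto simp: perturb_def two_sided_def field_simps)
  ultimately show ?thesis by simp
qed

lemma admissible_perturbI:
  assumes "(\<lambda>x. indicator hemisphere x * h (fst x) (snd x)) \<in> borel_measurable borel"
    and "\<And>\<theta> \<phi>. (\<theta>, \<phi>) \<in> hemisphere \<Longrightarrow> \<bar>\<epsilon> * h \<theta> \<phi>\<bar> \<le> r \<theta> \<phi> \<and> r \<theta> \<phi> + \<bar>\<epsilon> * h \<theta> \<phi>\<bar> \<le> R \<theta> \<phi>"
  shows "admissible R (perturb h \<epsilon>)"
proof -
  have "(\<lambda>x. indicator hemisphere x * r (fst x) (snd x) + \<epsilon> * (indicator hemisphere x * h (fst x) (snd x)))
    \<in> borel_measurable borel"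
    by (intro borel_measurable_add borel_measurable_times borel_measurable_const r_meas assms)
  moreover have "0 \<le> r \<theta> \<phi> + \<epsilon> * h \<theta> \<phi> \<and> r \<theta> \<phi> + \<epsilon> * h \<theta> \<phi> \<le> R \<theta> \<phi>" if "(\<theta>, \<phi>) \<in> hemisphere" for \<theta> \<phi>
    using assms(2)[OF that] by linarith
  ultimately show ?thesis
    by (auto simp: admissible_eq perturb_def algebra_simps)
qed

lemma admissible_perturb:
  assumes "two_sided h e" "\<bar>\<epsilon>\<bar> \<le> e"
  shows "admissible R (perturb h \<epsilon>)"
proof (rule admissible_perturbI[OF two_sided_meas[OF assms(1)]])
  fix \<theta> \<phi> assume x: "(\<theta>, \<phi>) \<in> hemisphere"
  have "\<bar>\<epsilon> * h \<theta> \<phi>\<bar> \<le> e * \<bar>h \<theta> \<phi>\<bar>"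
    using assms(2) by (simp add: abs_mult mult_right_mono)
  then show "\<bar>\<epsilon> * h \<theta> \<phi>\<bar> \<le> r \<theta> \<phi> \<and> r \<theta> \<phi> + \<bar>\<epsilon> * h \<theta> \<phi>\<bar> \<le> R \<theta> \<phi>"
    using two_sided_bounds[OF assms(1) x] by linarith
qed

text \<open>These are, up to constants, the coefficients in the expansion of
  \<open>(r + \<epsilon> * h) ^ 3\<close>. Since \<open>e * \<bar>h\<bar> \<le> r\<close>, each is
  dominated by \<open>r ^ 3 / e ^ j\<close>, hence by a multiple of the volume integrand.\<close>

lemma integrable_moment:
  assumes h: "two_sided h e" and ij: "i + j = 3"
  shows "integrable lborel
    (\<lambda>x. indicator hemisphere x * (sin (fst x) * r (fst x) (snd x) ^ i * h (fst x) (snd x) ^ j))"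
    (is "integrable _ ?g")
proof (rule Bochner_Integration.integrable_bound)
  show "integrable lborel (\<lambda>x. (3 / e ^ j) * vol_shell r x)"
    using volume_eq(2)[OF admissible_r] by simp
  have [measurable]: "(\<lambda>x::real \<times> real. sin (fst x)) \<in> borel_measurable borel"
    by (intro borel_measurable_continuous_onI continuous_intros)
  note [measurable] = r_meas two_sided_meas[OF h]
  have "?g = (\<lambda>x. indicator hemisphere x * (sin (fst x)
      * (indicator hemisphere x * r (fst x) (snd x)) ^ i * (indicator hemisphere x * h (fst x) (snd x)) ^ j))"
    by (auto simp: indicator_def)
  also have "\<dots> \<in> borel_measurable borel" by measurable
  finally show "?g \<in> borel_measurable lborel" by simp
  show "AE x in lborel. norm (?g x) \<le> norm (3 / e ^ j * vol_shell r x)"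
  proof (intro AE_I2)
    fix x :: "real \<times> real"
    show "norm (?g x) \<le> norm (3 / e ^ j * vol_shell r x)"
    proof (cases "x \<in> hemisphere")
      case True
      define rx hx where "rx = r (fst x) (snd x)" and "hx = h (fst x) (snd x)"
      have e: "0 < e" using h by (simp add: two_sided_def)
      have b: "e * \<bar>hx\<bar> \<le> rx" using two_sided_bounds(1)[OF h, of "fst x" "snd x"] True
        by (simp add: rx_def hx_def)
      have s: "0 \<le> sin (fst x)" using hemisphere_sin_nonneg[OF True] .
      have rx: "0 \<le> rx" using b e by (meson abs_ge_zero less_imp_le mult_nonneg_nonneg order_trans)
      have "(e * \<bar>hx\<bar>) ^ j \<le> rx ^ j" using b e by (intro power_mono) auto
      then have "\<bar>hx\<bar> ^ j \<le> rx ^ j / e ^ j" using e by (simp add: field_simps)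
      then have "sin (fst x) * rx ^ i * \<bar>hx\<bar> ^ j \<le> sin (fst x) * rx ^ i * (rx ^ j / e ^ j)"
        using s rx by (intro mult_left_mono) auto
      also have "\<dots> = sin (fst x) * rx ^ 3 / e ^ j" by (simp flip: ij add: power_add)
      finally show ?thesis
        using True s rx e by (simp add: vol_shell[OF admissible_r] abs_mult power_abs flip: rx_def hx_def)
    qed simp
  qed
qed

lemma integrable_flux_density: "two_sided h e \<Longrightarrow> integrable lborel (flux_density h)"
  using integrable_moment[of h e 2 1] by (simp add: flux_density_def[abs_def])

text \<open>For small \<open>\<epsilon>\<close> the volume is exactly a cubic polynomial in
  \<open>\<epsilon>\<close> whose linear coefficient is the flux, so no limit has to be exchanged
  with an integral.\<close>

lemma volume_perturb_deriv:
  assumes h: "two_sided h e"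
  shows "((\<lambda>\<epsilon>. volume (perturb h \<epsilon>)) has_real_derivative flux h) (at 0)"
proof -
  define m2 where "m2 x = indicator hemisphere x * (sin (fst x) * r (fst x) (snd x) ^ 1 * h (fst x) (snd x) ^ 2)" for x
  define m3 where "m3 x = indicator hemisphere x * (sin (fst x) * r (fst x) (snd x) ^ 0 * h (fst x) (snd x) ^ 3)" for x
  have i: "integrable lborel (vol_shell r)" "integrable lborel (flux_density h)"
    "integrable lborel m2" "integrable lborel m3"
    using volume_eq(2)[OF admissible_r] integrable_flux_density[OF h] integrable_moment[OF h, of 1 2]
      integrable_moment[OF h, of 0 3] by (simp_all add: m2_def[abs_def] m3_def[abs_def])
  have eq: "volume (perturb h \<epsilon>) = volume r + \<epsilon> * flux h + \<epsilon>\<^sup>2 * (LBINT x. m2 x) + \<epsilon> ^ 3 / 3 * (LBINT x. m3 x)"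
    if "\<bar>\<epsilon>\<bar> < e" for \<epsilon>
  proof -
    have ad: "admissible R (perturb h \<epsilon>)" using admissible_perturb[OF h] that by simp
    have "volume (perturb h \<epsilon>) = (LBINT x. vol_shell r x + \<epsilon> * flux_density h x + \<epsilon>\<^sup>2 * m2 x + \<epsilon> ^ 3 / 3 * m3 x)"
      unfolding volume_eq(1)[OF ad]
      by (intro Bochner_Integration.integral_cong refl, unfold vol_shell[OF ad] vol_shell[OF admissible_r])
        (simp add: perturb_def flux_density_def m2_def m3_def field_simps power3_eq_cube power2_eq_square)
    then show ?thesis using i by (simp add: volume_eq(1)[OF admissible_r] flux_def)
  qed
  have "((\<lambda>\<epsilon>. volume r + \<epsilon> * flux h + \<epsilon>\<^sup>2 * (LBINT x. m2 x) + \<epsilon> ^ 3 / 3 * (LBINT x. m3 x))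
      has_real_derivative flux h) (at 0)"
    by (auto intro!: derivative_eq_intros)
  then show ?thesis
    by (rule has_field_derivative_transform_within[of _ _ _ _ e])
      (use eq h in \<open>auto simp: two_sided_def dist_real_def\<close>)
qed

text \<open>If \<open>w\<close> were positive, a small step along \<open>h\<close> would lower the
  volume while the minorant \<open>W\<close>, and with it the interference, does not fall below its
  value at \<open>r\<close>: a better feasible zone. A differentiable minorant stands in for the
  interference, which may fail to be differentiable.\<close>

lemma no_descent:
  assumes h: "two_sided h e" "flux h < 0"
    and W: "W 0 = 0" "(W has_real_derivative w) (at 0)"
    and ge: "\<forall>\<^sub>F \<epsilon> in at_right 0. W \<epsilon> \<le> interference (perturb h \<epsilon>) - interference r"
  shows "w \<le> 0"
proof (rule ccontr)
  assume "\<not> w \<le> 0"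
  then obtain d1 where d1: "0 < d1" "\<And>\<epsilon>. 0 < \<epsilon> \<Longrightarrow> \<epsilon> < d1 \<Longrightarrow> 0 < W \<epsilon>"
    using DERIV_pos_inc_right[OF W(2)] W(1) by auto
  obtain d2 where d2: "0 < d2" "\<And>\<epsilon>. 0 < \<epsilon> \<Longrightarrow> \<epsilon> < d2 \<Longrightarrow> volume (perturb h \<epsilon>) < volume r"
    using DERIV_neg_dec_right[OF volume_perturb_deriv[OF h(1)] h(2)] by auto
  obtain d3 where d3: "0 < d3" "\<And>\<epsilon>. 0 < \<epsilon> \<Longrightarrow> \<epsilon> < d3 \<Longrightarrow> W \<epsilon> \<le> interference (perturb h \<epsilon>) - interference r"
    using ge by (auto simp: eventually_at_right_field)
  define \<epsilon> where "\<epsilon> = min (min d1 d2) (min d3 e) / 2"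
  have \<epsilon>: "0 < \<epsilon>" "\<epsilon> < d1" "\<epsilon> < d2" "\<epsilon> < d3" "\<epsilon> \<le> e"
    using d1 d2 d3 h by (auto simp: \<epsilon>_def two_sided_def)
  have "interference r \<le> interference (perturb h \<epsilon>)" using d1 d3 \<epsilon> by fastforce
  then have "volume r \<le> volume (perturb h \<epsilon>)"
    using r_minimal[of "perturb h \<epsilon>"] admissible_perturb[OF h(1), of \<epsilon>] \<epsilon> r_feasible by simp
  then show False using d2 \<epsilon> by force
qed

text \<open>On a patch the boundary can be moved by up to \<open>\<delta>\<close> either way; the bound \<open>N\<close> on \<open>r\<close> also bounds there
  every two-sided direction.\<close>

definition patch :: "(real \<times> real) set \<Rightarrow> real \<Rightarrow> real \<Rightarrow> bool" where
  "patch A \<delta> N \<longleftrightarrow> A \<in> sets borel \<and> A \<notin> null_sets lborel \<and> A \<subseteq> hemisphere \<and> 0 < \<delta> \<and>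
    (\<forall>(\<theta>, \<phi>)\<in>A. 0 < sin \<theta> \<and> \<delta> < r \<theta> \<phi> \<and> r \<theta> \<phi> + \<delta> < R \<theta> \<phi> \<and> r \<theta> \<phi> \<le> N)"

definition bump :: "(real \<Rightarrow> real \<Rightarrow> real) \<Rightarrow> real \<Rightarrow> (real \<times> real) set \<Rightarrow> real \<Rightarrow> real \<Rightarrow> real" where
  "bump h c A = (\<lambda>\<theta> \<phi>. h \<theta> \<phi> + c * indicator A (\<theta>, \<phi>))"

lemma two_sided_bump:
  assumes A: "patch A \<delta> N" and h: "two_sided h e"
  obtains d where "two_sided (bump h c A) d" "d \<le> e"
    and "\<And>\<theta> \<phi> \<epsilon>. (\<theta>, \<phi>) \<in> A \<Longrightarrow> \<bar>\<epsilon>\<bar> \<le> d \<Longrightarrow> \<bar>\<epsilon> * h \<theta> \<phi>\<bar> + \<bar>\<epsilon> * c\<bar> \<le> \<delta>"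
proof -
  have e: "0 < e" using h by (simp add: two_sided_def)
  \<comment> \<open>On the patch \<open>e * \<bar>h\<bar> \<le> r \<le> N\<close>, hence
    \<open>\<bar>h\<bar> \<le> \<bar>N\<bar> / e\<close>. With this \<open>d\<close> the total
    displacement stays within the margin \<open>\<delta>\<close>; the summand \<open>1\<close> keeps
    the denominator positive. Off the patch the direction is still \<open>h\<close>, and
    \<open>d \<le> e\<close> suffices.\<close>
  define d where "d = min e (\<delta> / (\<bar>N\<bar> / e + \<bar>c\<bar> + 1))"
  have pos: "0 < \<bar>N\<bar> / e + \<bar>c\<bar> + 1" using e by (simp add: add_nonneg_pos)
  then have d: "0 < d" "d \<le> e" "d \<le> \<delta> / (\<bar>N\<bar> / e + \<bar>c\<bar> + 1)"
    using A e by (auto simp: d_def patch_def)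
  then have d3: "d * (\<bar>N\<bar> / e + \<bar>c\<bar> + 1) \<le> \<delta>" using pos by (simp add: pos_le_divide_eq)
  have sm: "\<bar>\<epsilon> * h \<theta> \<phi>\<bar> + \<bar>\<epsilon> * c\<bar> \<le> \<delta>" if x: "(\<theta>, \<phi>) \<in> A" and \<epsilon>: "\<bar>\<epsilon>\<bar> \<le> d" for \<theta> \<phi> \<epsilon>
  proof -
    have "(\<theta>, \<phi>) \<in> hemisphere" "r \<theta> \<phi> \<le> N" using A x by (auto simp: patch_def)
    then have "e * \<bar>h \<theta> \<phi>\<bar> \<le> \<bar>N\<bar>" using two_sided_bounds(1)[OF h, of \<theta> \<phi>] by linarith
    then have "\<bar>h \<theta> \<phi>\<bar> \<le> \<bar>N\<bar> / e" using e by (simp add: field_simps)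
    then have "\<bar>\<epsilon>\<bar> * (\<bar>h \<theta> \<phi>\<bar> + \<bar>c\<bar>) \<le> d * (\<bar>N\<bar> / e + \<bar>c\<bar> + 1)"
      using \<epsilon> d by (intro mult_mono) auto
    then show ?thesis using d3 by (simp add: abs_mult algebra_simps)
  qed
  have "(\<lambda>x. indicator hemisphere x * h (fst x) (snd x) + c * indicator A x) \<in> borel_measurable borel"
    using two_sided_meas[OF h] A by (auto simp: patch_def)
  moreover have "(\<lambda>x. indicator hemisphere x * h (fst x) (snd x) + c * indicator A x)
     = (\<lambda>x. indicator hemisphere x * bump h c A (fst x) (snd x))"
    using A by (auto simp: bump_def indicator_def patch_def fun_eq_iff)
  ultimately have m: "(\<lambda>x. indicator hemisphere x * bump h c A (fst x) (snd x)) \<in> borel_measurable borel"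
    by simp
  have ad: "admissible R (perturb (bump h c A) \<epsilon>)" if \<epsilon>: "\<bar>\<epsilon>\<bar> \<le> d" for \<epsilon>
  proof (rule admissible_perturbI[OF m])
    fix \<theta> \<phi> assume x: "(\<theta>, \<phi>) \<in> hemisphere"
    show "\<bar>\<epsilon> * bump h c A \<theta> \<phi>\<bar> \<le> r \<theta> \<phi> \<and> r \<theta> \<phi> + \<bar>\<epsilon> * bump h c A \<theta> \<phi>\<bar> \<le> R \<theta> \<phi>"
    proof (cases "(\<theta>, \<phi>) \<in> A")
      case True
      then have "\<delta> < r \<theta> \<phi> \<and> r \<theta> \<phi> + \<delta> < R \<theta> \<phi>" using A by (auto simp: patch_def)
      moreover have "\<bar>\<epsilon> * bump h c A \<theta> \<phi>\<bar> \<le> \<delta>"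
        using sm[OF True \<epsilon>] True by (simp add: bump_def distrib_left)
      ultimately show ?thesis by linarith
    next
      case False
      have "\<bar>\<epsilon> * h \<theta> \<phi>\<bar> \<le> e * \<bar>h \<theta> \<phi>\<bar>"
        using \<epsilon> d by (simp add: abs_mult mult_right_mono)
      then show ?thesis using two_sided_bounds[OF h x] False by (simp add: bump_def)
    qed
  qed
  show ?thesis
    using that[of d] sm d ad[of d] ad[of "- d"] by (simp add: two_sided_def)
qed

corollary two_sided_bump_exists:
  "patch A \<delta> N \<Longrightarrow> two_sided h e \<Longrightarrow> \<exists>d. two_sided (bump h c A) d"
  by (rule two_sided_bump[of A \<delta> N h e c]) auto

lemma two_sided_zero: "two_sided (\<lambda>\<theta> \<phi>. 0) 1"
  by (simp add: two_sided_def admissible_r)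

lemma flux_bump:
  assumes A: "patch A \<delta> N" and h: "two_sided h e"
  shows "flux (bump h c A) = flux h + c * flux (bump (\<lambda>\<theta> \<phi>. 0) 1 A)"
proof -
  obtain d where d: "two_sided (bump (\<lambda>\<theta> \<phi>. 0) 1 A) d"
    using two_sided_bump_exists[OF A two_sided_zero] by blast
  have "flux_density (bump h c A) = (\<lambda>x. flux_density h x + c * flux_density (bump (\<lambda>\<theta> \<phi>. 0) 1 A) x)"
    by (simp add: fun_eq_iff flux_density_def bump_def algebra_simps)
  then show ?thesis
    using integrable_flux_density[OF d] integrable_flux_density[OF h] by (simp add: flux_def)
qed

text \<open>The integrand is \<open>sin \<theta>\<close> times the square of \<open>r\<close> on the
  patch, positive on a set that is not null. Dividing by this flux is how bumps are normalised
  later.\<close>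

lemma flux_patch_pos:
  assumes A: "patch A \<delta> N"
  shows "0 < flux (bump (\<lambda>\<theta> \<phi>. 0) 1 A)"
proof -
  let ?f = "flux_density (bump (\<lambda>\<theta> \<phi>. 0) 1 A)"
  obtain d where d: "two_sided (bump (\<lambda>\<theta> \<phi>. 0) 1 A) d"
    using two_sided_bump_exists[OF A two_sided_zero] by blast
  have nn: "0 \<le> ?f x" for x
    using hemisphere_sin_nonneg[of x] by (auto simp: flux_density_def bump_def indicator_def)
  have "\<not> (AE x in lborel. ?f x = 0)"
  proof
    assume "AE x in lborel. ?f x = 0"
    moreover have "?f x \<noteq> 0" if "x \<in> A" for x
    proof -
      from that A have "x \<in> hemisphere" "0 < sin (fst x)" "0 < r (fst x) (snd x)"
        unfolding patch_def by fastforce+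
      with that show ?thesis by (simp add: flux_density_def bump_def)
    qed
    ultimately have "AE x in lborel. x \<notin> A" by (auto elim: eventually_mono)
    then have "A \<in> null_sets lborel" using A by (subst (asm) AE_iff_null_sets[symmetric]) (auto simp: patch_def)
    with A show False by (simp add: patch_def)
  qed
  then have "flux (bump (\<lambda>\<theta> \<phi>. 0) 1 A) \<noteq> 0"
    using integral_nonneg_eq_0_iff_AE[OF integrable_flux_density[OF d]] nn by (simp add: flux_def)
  moreover have "0 \<le> flux (bump (\<lambda>\<theta> \<phi>. 0) 1 A)"
    unfolding flux_def using nn by simp
  ultimately show ?thesis by simp
qed

text \<open>The two boundaries differ only over \<open>A\<close>, and for small
  \<open>\<epsilon>\<close> every radius between them is within \<open>\<delta>\<close> of
  \<open>r\<close>, where \<open>f\<close> is controlled. The sign of \<open>c\<close> decides which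
  bound is needed. The comparison starts from \<open>perturb h \<epsilon>\<close> rather than from
  \<open>r\<close>, so that bumps can be stacked.\<close>

lemma bump_gain:
  assumes A: "patch A \<delta> N" and h: "two_sided h e"
    and f: "\<And>\<theta> \<phi> \<rho>. (\<theta>, \<phi>) \<in> A \<Longrightarrow> \<bar>\<rho> - r \<theta> \<phi>\<bar> \<le> \<delta> \<Longrightarrow> (0 < c \<longrightarrow> m \<le> f \<theta> \<phi> \<rho>) \<and> (c < 0 \<longrightarrow> f \<theta> \<phi> \<rho> \<le> m)"
  shows "\<forall>\<^sub>F \<epsilon> in at_right 0. m * (volume (perturb (bump h c A) \<epsilon>) - volume (perturb h \<epsilon>))
     \<le> interference (perturb (bump h c A) \<epsilon>) - interference (perturb h \<epsilon>)"
proof -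
  obtain d where d: "two_sided (bump h c A) d" "d \<le> e"
    and sm: "\<And>\<theta> \<phi> \<epsilon>. (\<theta>, \<phi>) \<in> A \<Longrightarrow> \<bar>\<epsilon>\<bar> \<le> d \<Longrightarrow> \<bar>\<epsilon> * h \<theta> \<phi>\<bar> + \<bar>\<epsilon> * c\<bar> \<le> \<delta>"
    using two_sided_bump[OF A h, where c = c] by metis
  have "m * (volume (perturb (bump h c A) \<epsilon>) - volume (perturb h \<epsilon>))
     \<le> interference (perturb (bump h c A) \<epsilon>) - interference (perturb h \<epsilon>)" if \<epsilon>: "0 < \<epsilon>" "\<epsilon> < d" for \<epsilon>
  proof (rule interference_diff_ge)
    show "admissible R (perturb h \<epsilon>)" "admissible R (perturb (bump h c A) \<epsilon>)"
      using admissible_perturb[OF h] admissible_perturb[OF d(1)] \<epsilon> d by auto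
    fix \<theta> \<phi> \<rho>
    have near: "\<bar>\<rho> - r \<theta> \<phi>\<bar> \<le> \<delta>" if "(\<theta>, \<phi>) \<in> A"
      "min (\<epsilon> * h \<theta> \<phi>) (\<epsilon> * h \<theta> \<phi> + \<epsilon> * c) \<le> \<rho> - r \<theta> \<phi>" "\<rho> - r \<theta> \<phi> \<le> max (\<epsilon> * h \<theta> \<phi>) (\<epsilon> * h \<theta> \<phi> + \<epsilon> * c)"
      using sm[OF that(1), of \<epsilon>] that \<epsilon> by linarith
    {
      assume lt: "perturb h \<epsilon> \<theta> \<phi> < \<rho>" "\<rho> < perturb (bump h c A) \<epsilon> \<theta> \<phi>"
      then have x: "(\<theta>, \<phi>) \<in> A" by (cases "(\<theta>, \<phi>) \<in> A") (auto simp: perturb_def bump_def)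
      with lt have "0 < \<epsilon> * c" by (simp add: perturb_def bump_def distrib_left)
      then have "0 < c" using \<epsilon> by (simp add: zero_less_mult_iff)
      then show "m \<le> f \<theta> \<phi> \<rho>" using f[OF x near[OF x]] lt x by (simp add: perturb_def bump_def distrib_left)
    next
      assume lt: "perturb (bump h c A) \<epsilon> \<theta> \<phi> < \<rho>" "\<rho> < perturb h \<epsilon> \<theta> \<phi>"
      then have x: "(\<theta>, \<phi>) \<in> A" by (cases "(\<theta>, \<phi>) \<in> A") (auto simp: perturb_def bump_def)
      with lt have "\<epsilon> * c < 0" by (simp add: perturb_def bump_def distrib_left)
      then have "c < 0" using \<epsilon> by (simp add: mult_less_0_iff)
      then show "f \<theta> \<phi> \<rho> \<le> m" using f[OF x near[OF x]] lt x by (simp add: perturb_def bump_def distrib_left)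
    }
  qed
  then show ?thesis using d by (auto simp: eventually_at_right_field two_sided_def)
qed

subsection \<open>The density on the boundary\<close>

definition free :: "real \<times> real \<Rightarrow> bool" where
  "free x \<longleftrightarrow> x \<in> hemisphere \<and> 0 < r (fst x) (snd x) \<and> r (fst x) (snd x) < R (fst x) (snd x)"

definition boundary_density :: "real \<times> real \<Rightarrow> real" where
  "boundary_density x = f (fst x) (snd x) (r (fst x) (snd x))"

text \<open>Every free point with \<open>sin \<theta> > 0\<close> whose density lies in the interior of \<open>C\<close> is in \<open>fit C k\<close> for
  large \<open>k\<close>. Rational offsets make this set measurable, and by continuity of \<open>f\<close> in \<open>\<rho>\<close> they control
  all real ones.\<close>

definition fit :: "real set \<Rightarrow> nat \<Rightarrow> real \<times> real \<Rightarrow> bool" where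
  "fit C k x \<longleftrightarrow> x \<in> hemisphere \<and> 0 < sin (fst x) \<and> r (fst x) (snd x) \<le> real k
     \<and> 2 / real (Suc k) < r (fst x) (snd x) \<and> r (fst x) (snd x) + 2 / real (Suc k) < R (fst x) (snd x)
     \<and> (\<forall>q::rat. \<bar>real_of_rat q\<bar> < 2 / real (Suc k) \<longrightarrow> f (fst x) (snd x) (r (fst x) (snd x) + real_of_rat q) \<in> C)"

lemma sets_fit:
  assumes C: "closed C"
  shows "{x. fit C k x} \<in> sets borel"
proof -
  \<comment> \<open>Measurability is given only on \<open>region R\<close> and on the hemisphere.
    The extensions by zero are Borel everywhere, and the margins in \<open>fit\<close> keep every
    tested radius inside \<open>region R\<close>, where they agree with the originals.\<close>
  define f0 where "f0 = (\<lambda>z. indicator (region R) z *\<^sub>R (case z of (\<theta>, \<phi>, \<rho>) \<Rightarrow> f \<theta> \<phi> \<rho>))"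
  define r0 where "r0 = (\<lambda>x. indicator hemisphere x * r (fst x) (snd x))"
  define R0 where "R0 = (\<lambda>x. indicator hemisphere x * R (fst x) (snd x))"
  have f0 [measurable]: "f0 \<in> borel_measurable borel"
    using f_meas by (simp add: f0_def set_borel_measurable_def)
  have [measurable]: "r0 \<in> borel_measurable borel" "R0 \<in> borel_measurable borel"
    using r_meas admissible_meas[OF admissible_R] by (simp_all add: r0_def R0_def)
  have [measurable]: "C \<in> sets borel" using C by simp
  have [measurable]: "(fst :: real \<times> real \<Rightarrow> real) \<in> borel_measurable borel"
    "(snd :: real \<times> real \<Rightarrow> real) \<in> borel_measurable borel"
    "(\<lambda>x::real \<times> real. sin (fst x)) \<in> borel_measurable borel"
    by (intro borel_measurable_continuous_onI continuous_intros)+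
  have [measurable]: "(\<lambda>x. f0 (fst x, snd x, r0 x + q)) \<in> borel_measurable borel" for q
    by (rule measurable_compose[OF _ f0]) (intro borel_measurable_Pair; measurable)
  have "{x. fit C k x} = {x \<in> space borel. x \<in> hemisphere \<and> 0 < sin (fst x) \<and> r0 x \<le> real k
     \<and> 2 / real (Suc k) < r0 x \<and> r0 x + 2 / real (Suc k) < R0 x
     \<and> (\<forall>q::rat. \<bar>real_of_rat q\<bar> < 2 / real (Suc k) \<longrightarrow> f0 (fst x, snd x, r0 x + real_of_rat q) \<in> C)}"
    (is "_ = ?S")
  proof -
    have "fit C k x \<longleftrightarrow> x \<in> ?S" for x
    proof (cases "x \<in> hemisphere")
      case True
      have "f0 (fst x, snd x, r0 x + q) = f (fst x) (snd x) (r (fst x) (snd x) + q)"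
        if "2 / real (Suc k) < r (fst x) (snd x)" "r (fst x) (snd x) + 2 / real (Suc k) < R (fst x) (snd x)"
          "\<bar>q\<bar> < 2 / real (Suc k)" for q
      proof -
        have "(fst x, snd x, r (fst x) (snd x) + q) \<in> region R"
          using True that by (auto simp: region_def abs_less_iff)
        then show ?thesis using True by (simp add: f0_def r0_def)
      qed
      with True show ?thesis by (auto simp: fit_def r0_def R0_def)
    qed (simp add: fit_def)
    then show ?thesis by blast
  qed
  also have "\<dots> \<in> sets borel" by measurable
  finally show ?thesis .
qed

text \<open>As \<open>C\<close> is closed, a value outside \<open>C\<close> would persist on a whole
  interval of radii around \<open>\<rho>\<close>. That interval meets the margin in an open interval
  of offsets, which contains a rational one.\<close>

lemma fit_near:
  assumes C: "closed C" and x: "fit C k (\<theta>, \<phi>)" and \<rho>: "\<bar>\<rho> - r \<theta> \<phi>\<bar> < 2 / real (Suc k)"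
  shows "f \<theta> \<phi> \<rho> \<in> C"
proof (rule ccontr)
  assume out: "f \<theta> \<phi> \<rho> \<notin> C"
  define \<delta> where "\<delta> = 2 / real (Suc k)"
  have h: "(\<theta>, \<phi>) \<in> hemisphere" and b: "\<delta> < r \<theta> \<phi>" "r \<theta> \<phi> + \<delta> < R \<theta> \<phi>"
    and q: "\<And>q::rat. \<bar>real_of_rat q\<bar> < \<delta> \<Longrightarrow> f \<theta> \<phi> (r \<theta> \<phi> + real_of_rat q) \<in> C"
    using x by (auto simp: fit_def \<delta>_def)
  have "open {0<..<R \<theta> \<phi>}" by simp
  then have "open (f \<theta> \<phi> -` (- C) \<inter> {0<..<R \<theta> \<phi>})"
    using f_cont[OF h] open_Compl[OF C] continuous_on_open_vimage by blast
  moreover have "\<rho> \<in> f \<theta> \<phi> -` (- C) \<inter> {0<..<R \<theta> \<phi>}"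
    using out b \<rho> by (auto simp: \<delta>_def)
  ultimately obtain d where d: "0 < d" "ball \<rho> d \<subseteq> f \<theta> \<phi> -` (- C) \<inter> {0<..<R \<theta> \<phi>}"
    by (rule openE)
  have "max (- \<delta>) (\<rho> - r \<theta> \<phi> - d) < min \<delta> (\<rho> - r \<theta> \<phi> + d)"
    using d \<rho> by (auto simp: \<delta>_def)
  then obtain p :: rat where p: "max (- \<delta>) (\<rho> - r \<theta> \<phi> - d) < real_of_rat p" "real_of_rat p < min \<delta> (\<rho> - r \<theta> \<phi> + d)"
    using of_rat_dense by blast
  have "r \<theta> \<phi> + real_of_rat p \<in> ball \<rho> d"
    using p by (auto simp: dist_real_def)
  moreover have "\<bar>real_of_rat p\<bar> < \<delta>" using p by linarith
  ultimately show False using q[of p] subsetD[OF d(2)] by fast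
qed

lemma free_fit:
  assumes U: "open U" "U \<subseteq> C" and x: "free x" "0 < sin (fst x)" "boundary_density x \<in> U"
  shows "\<exists>k. fit C k x"
proof -
  obtain \<theta> \<phi> where x_eq: "x = (\<theta>, \<phi>)" by (cases x)
  have h: "(\<theta>, \<phi>) \<in> hemisphere" and r: "0 < r \<theta> \<phi>" "r \<theta> \<phi> < R \<theta> \<phi>" and fU: "f \<theta> \<phi> (r \<theta> \<phi>) \<in> U"
    using x by (auto simp: free_def x_eq boundary_density_def)
  have "open {0<..<R \<theta> \<phi>}" by simp
  then have "open (f \<theta> \<phi> -` U \<inter> {0<..<R \<theta> \<phi>})"
    using f_cont[OF h] U(1) continuous_on_open_vimage by blast
  moreover have "r \<theta> \<phi> \<in> f \<theta> \<phi> -` U \<inter> {0<..<R \<theta> \<phi>}" using r fU by simp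
  ultimately obtain d where d: "0 < d" "ball (r \<theta> \<phi>) d \<subseteq> f \<theta> \<phi> -` U \<inter> {0<..<R \<theta> \<phi>}"
    by (rule openE)
  \<comment> \<open>\<open>e\<close> is the room available around \<open>r\<close>: the radius on
    which \<open>f\<close> stays in \<open>U\<close>, the distance to the origin and the distance to
    the outer boundary. Any \<open>k\<close> above both \<open>r\<close> and \<open>2 / e\<close>
    then works.\<close>
  define e where "e = min d (min (r \<theta> \<phi>) (R \<theta> \<phi> - r \<theta> \<phi>))"
  have e: "0 < e" using d r by (simp add: e_def)
  obtain k :: nat where k: "max (r \<theta> \<phi>) (2 / e) < real k" using reals_Archimedean2 by blast
  have "2 / e < real (Suc k)" using k by simp
  then have "2 / real (Suc k) < e" using e by (simp add: field_simps)
  then have lt: "2 / real (Suc k) < d" "2 / real (Suc k) < r \<theta> \<phi>" "r \<theta> \<phi> + 2 / real (Suc k) < R \<theta> \<phi>"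
    by (auto simp: e_def)
  have "f \<theta> \<phi> (r \<theta> \<phi> + real_of_rat q) \<in> C" if "\<bar>real_of_rat q\<bar> < 2 / real (Suc k)" for q
  proof -
    have "r \<theta> \<phi> + real_of_rat q \<in> ball (r \<theta> \<phi>) d" using that lt by (simp add: dist_real_def)
    then show ?thesis using subsetD[OF d(2)] U(2) by fast
  qed
  then have "fit C k x" using h x(2) lt k by (simp add: fit_def x_eq)
  then show ?thesis ..
qed

text \<open>Openness of \<open>U\<close> puts almost every free point with density in
  \<open>U\<close> into some \<open>fit C k\<close>; closedness of \<open>C\<close> makes these sets
  measurable and extends the control to real offsets. Countably many null sets could not cover a set
  that is not null. The margin is halved so that the closed bound on the offset implies the strict
  one of \<open>fit_near\<close>.\<close>

lemma patch_exists:
  assumes U: "open U" "U \<subseteq> C" "closed C"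
    and pos: "\<not> (AE x in lborel. free x \<longrightarrow> boundary_density x \<notin> U)"
  obtains A \<delta> N where "patch A \<delta> N"
    and "\<And>\<theta> \<phi> \<rho>. (\<theta>, \<phi>) \<in> A \<Longrightarrow> \<bar>\<rho> - r \<theta> \<phi>\<bar> \<le> \<delta> \<Longrightarrow> f \<theta> \<phi> \<rho> \<in> C"
proof -
  have "\<exists>k. {x. fit C k x} \<notin> null_sets lborel"
  proof (rule ccontr)
    assume "\<not> ?thesis"
    then have "AE x in lborel. \<forall>k. x \<notin> {x. fit C k x}"
      unfolding AE_all_countable by (blast intro: AE_not_in)
    then have "AE x in lborel. free x \<longrightarrow> boundary_density x \<notin> U"
      using AE_hemisphere_sin_pos
      by eventually_elim (use free_fit[OF U(1,2)] in \<open>auto simp: free_def\<close>)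
    with pos show False by simp
  qed
  then obtain k where k: "{x. fit C k x} \<notin> null_sets lborel" by blast
  have lt: "1 / real (Suc k) < 2 / real (Suc k)" by (simp add: field_simps)
  have "patch {x. fit C k x} (1 / real (Suc k)) (real k)"
    unfolding patch_def using k sets_fit[OF U(3)] lt by (fastforce simp: fit_def)
  moreover have "f \<theta> \<phi> \<rho> \<in> C" if "(\<theta>, \<phi>) \<in> {x. fit C k x}" "\<bar>\<rho> - r \<theta> \<phi>\<bar> \<le> 1 / real (Suc k)" for \<theta> \<phi> \<rho>
    using fit_near[OF U(3)] that lt by force
  ultimately show ?thesis using that by blast
qed

section \<open>Exchange between patches of low and high density\<close>

lemma boundary_density_dichotomy:
  assumes ab: "0 \<le> \<alpha>" "\<alpha> < \<beta>"
  shows "(AE x in lborel. free x \<longrightarrow> \<alpha> \<le> boundary_density x) \<or> (AE x in lborel. free x \<longrightarrow> boundary_density x \<le> \<beta>)"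
proof (rule ccontr)
  assume "\<not> ?thesis"
  then have "\<not> (AE x in lborel. free x \<longrightarrow> boundary_density x \<notin> {..<\<alpha>})"
    and "\<not> (AE x in lborel. free x \<longrightarrow> boundary_density x \<notin> {\<beta><..})"
    by (auto simp: not_less)
  note low = this(1) and high = this(2)
  obtain A d N where A: "patch A d N"
    and fA: "\<And>\<theta> \<phi> \<rho>. (\<theta>, \<phi>) \<in> A \<Longrightarrow> \<bar>\<rho> - r \<theta> \<phi>\<bar> \<le> d \<Longrightarrow> f \<theta> \<phi> \<rho> \<in> {..\<alpha>}"
    by (rule patch_exists[OF _ _ _ low, of "{..\<alpha>}"]) auto
  obtain B d' N' where B: "patch B d' N'"
    and fB: "\<And>\<theta> \<phi> \<rho>. (\<theta>, \<phi>) \<in> B \<Longrightarrow> \<bar>\<rho> - r \<theta> \<phi>\<bar> \<le> d' \<Longrightarrow> f \<theta> \<phi> \<rho> \<in> {\<beta>..}"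
    by (rule patch_exists[OF _ _ _ high, of "{\<beta>..}"]) auto
  define M where "M = (\<lambda>A. flux (bump (\<lambda>\<theta> \<phi>. 0) 1 A))"
  have M: "0 < M A" "0 < M B" using flux_patch_pos A B by (auto simp: M_def)
  \<comment> \<open>Receding over \<open>A\<close> removes volume at rate \<open>1\<close>, and
    advancing over \<open>B\<close> restores it at rate
    \<open>(\<alpha> + \<beta>) / (2 * \<beta>) < 1\<close>, where \<open>\<beta>\<close> is
    positive because \<open>\<alpha>\<close> is nonnegative. The volume falls, yet the guaranteed
    rate of interference is \<open>- \<alpha> + (\<alpha> + \<beta>) / 2 = (\<beta> - \<alpha>) / 2
    > 0\<close>.\<close>
  define c where "c = - 1 / M A"
  define c' where "c' = (\<alpha> + \<beta>) / (2 * \<beta>) / M B"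
  define h where "h = bump (\<lambda>\<theta> \<phi>. 0) c A"
  define h' where "h' = bump h c' B"
  obtain e where h: "two_sided h e" using two_sided_bump_exists[OF A two_sided_zero] unfolding h_def by blast
  obtain e' where h': "two_sided h' e'" using two_sided_bump_exists[OF B h] unfolding h'_def by blast
  have "flux h = flux (\<lambda>\<theta> \<phi>. 0) + c * M A"
    unfolding h_def M_def by (rule flux_bump[OF A two_sided_zero])
  then have fl: "flux h = - 1" using M by (simp add: c_def flux_def flux_density_def[abs_def])
  have "flux h' = flux h + c' * M B"
    unfolding h'_def M_def by (rule flux_bump[OF B h])
  then have fl': "flux h' = (\<alpha> + \<beta>) / (2 * \<beta>) - 1" using M fl by (simp add: c'_def)
  define W where "W = (\<lambda>\<epsilon>. \<alpha> * (volume (perturb h \<epsilon>) - volume r)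
    + \<beta> * (volume (perturb h' \<epsilon>) - volume (perturb h \<epsilon>)))"
  have "(W has_real_derivative \<alpha> * flux h + \<beta> * (flux h' - flux h)) (at 0)"
    unfolding W_def
    by (auto intro!: derivative_eq_intros volume_perturb_deriv[OF h] volume_perturb_deriv[OF h'])
  moreover have "\<forall>\<^sub>F \<epsilon> in at_right 0. W \<epsilon> \<le> interference (perturb h' \<epsilon>) - interference r"
  proof -
    have "\<forall>\<^sub>F \<epsilon> in at_right 0. \<alpha> * (volume (perturb h \<epsilon>) - volume r) \<le> interference (perturb h \<epsilon>) - interference r"
      unfolding h_def
    proof (rule bump_gain[OF A two_sided_zero, unfolded perturb_zero])
      have "c < 0" using M by (simp add: c_def)
      then show "(0 < c \<longrightarrow> \<alpha> \<le> f \<theta> \<phi> \<rho>) \<and> (c < 0 \<longrightarrow> f \<theta> \<phi> \<rho> \<le> \<alpha>)"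
        if "(\<theta>, \<phi>) \<in> A" "\<bar>\<rho> - r \<theta> \<phi>\<bar> \<le> d" for \<theta> \<phi> \<rho> using fA[OF that] by simp
    qed
    moreover have "\<forall>\<^sub>F \<epsilon> in at_right 0. \<beta> * (volume (perturb h' \<epsilon>) - volume (perturb h \<epsilon>))
        \<le> interference (perturb h' \<epsilon>) - interference (perturb h \<epsilon>)"
      unfolding h'_def
    proof (rule bump_gain[OF B h])
      have "0 < c'" using M ab by (simp add: c'_def)
      then show "(0 < c' \<longrightarrow> \<beta> \<le> f \<theta> \<phi> \<rho>) \<and> (c' < 0 \<longrightarrow> f \<theta> \<phi> \<rho> \<le> \<beta>)"
        if "(\<theta>, \<phi>) \<in> B" "\<bar>\<rho> - r \<theta> \<phi>\<bar> \<le> d'" for \<theta> \<phi> \<rho> using fB[OF that] by simp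
    qed
    ultimately show ?thesis by eventually_elim (simp add: W_def)
  qed
  moreover have "flux h' < 0" unfolding fl' using ab by (simp add: field_simps)
  moreover have "W 0 = 0" by (simp add: W_def)
  ultimately have "\<alpha> * flux h + \<beta> * (flux h' - flux h) \<le> 0"
    using no_descent[OF h'] by blast
  then show False using ab by (simp add: fl fl' field_simps)
qed

lemma boundary_density_nonneg: "free x \<Longrightarrow> 0 \<le> boundary_density x"
  by (auto simp: free_def boundary_density_def region_def intro!: f_nonneg)

text \<open>The constant is the essential infimum of the density over the free points, the supremum
  of the set \<open>T\<close> of essential lower bounds. It is finite because the free points are
  not null, and nonnegative because \<open>f\<close> is. A level slightly above it is no longer an
  essential lower bound, so by the dichotomy every still higher level is an essential upper
  bound.\<close>

lemma boundary_density_constant: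
  obtains \<mu> where "AE x in lborel. free x \<longrightarrow> boundary_density x = \<mu>"
proof (cases "AE x in lborel. \<not> free x")
  case True
  then show ?thesis by (intro that[of 0]) (auto elim: eventually_mono)
next
  case False
  define T where "T = {\<alpha>. AE x in lborel. free x \<longrightarrow> \<alpha> \<le> boundary_density x}"
  have T0: "0 \<in> T" using boundary_density_nonneg by (auto simp: T_def)
  have bdd: "bdd_above T"
  proof -
    obtain n :: nat where n: "\<not> (AE x in lborel. free x \<longrightarrow> real n \<le> boundary_density x)"
    proof (rule ccontr)
      assume "\<not> thesis"
      then have "AE x in lborel. \<forall>n::nat. free x \<longrightarrow> real n \<le> boundary_density x"
        using that unfolding AE_all_countable by blast
      then have "AE x in lborel. \<not> free x"
      proof eventually_elim
        case (elim x)
        then show ?case using reals_Archimedean2[of "boundary_density x"] by (meson not_less)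
      qed
      with False show False by simp
    qed
    have "t \<le> real n" if t: "t \<in> T" for t
    proof (rule ccontr)
      assume "\<not> t \<le> real n"
      then have "AE x in lborel. free x \<longrightarrow> real n \<le> boundary_density x"
        using t by (auto simp: T_def elim!: eventually_mono)
      with n show False by simp
    qed
    then show ?thesis by (auto simp: bdd_above_def)
  qed
  define \<mu> where "\<mu> = Sup T"
  have \<mu>: "0 \<le> \<mu>" using cSup_upper[OF T0 bdd] by (simp add: \<mu>_def)
  have lower: "AE x in lborel. free x \<longrightarrow> \<mu> - 1 / real (Suc k) \<le> boundary_density x" for k
  proof -
    have "\<mu> - 1 / real (Suc k) < Sup T" by (simp add: \<mu>_def)
    then obtain t where "t \<in> T" "\<mu> - 1 / real (Suc k) < t"
      using less_cSup_iff[of T] T0 bdd by blast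
    then show ?thesis by (auto simp: T_def elim!: eventually_mono)
  qed
  have upper: "AE x in lborel. free x \<longrightarrow> boundary_density x \<le> \<mu> + 2 / real (Suc k)" for k
  proof -
    have "\<mu> + 1 / real (Suc k) \<notin> T"
    proof
      assume "\<mu> + 1 / real (Suc k) \<in> T"
      from cSup_upper[OF this bdd] show False by (simp add: \<mu>_def)
    qed
    moreover have "0 \<le> \<mu> + 1 / real (Suc k)" "\<mu> + 1 / real (Suc k) < \<mu> + 2 / real (Suc k)"
      using \<mu> by (auto simp: field_simps)
    ultimately show ?thesis
      using boundary_density_dichotomy[of "\<mu> + 1 / real (Suc k)" "\<mu> + 2 / real (Suc k)"]
      unfolding T_def mem_Collect_eq by blast
  qed
  have "AE x in lborel. \<forall>k. free x \<longrightarrow> \<mu> - 1 / real (Suc k) \<le> boundary_density x"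
    "AE x in lborel. \<forall>k. free x \<longrightarrow> boundary_density x \<le> \<mu> + 2 / real (Suc k)"
    unfolding AE_all_countable using lower upper by auto
  then have "AE x in lborel. free x \<longrightarrow> boundary_density x = \<mu>"
  proof eventually_elim
    case (elim x)
    show ?case
    proof
      assume x: "free x"
      have "(\<lambda>k. \<mu> - 1 * inverse (real (Suc k))) \<longlonglongrightarrow> \<mu> - 1 * 0"
        "(\<lambda>k. \<mu> + 2 * inverse (real (Suc k))) \<longlonglongrightarrow> \<mu> + 2 * 0"
        by (intro tendsto_intros LIMSEQ_inverse_real_of_nat)+
      then have lim: "(\<lambda>k. \<mu> - 1 / real (Suc k)) \<longlonglongrightarrow> \<mu>" "(\<lambda>k. \<mu> + 2 / real (Suc k)) \<longlonglongrightarrow> \<mu>"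
        by (simp_all add: divide_inverse)
      show "boundary_density x = \<mu>"
        using LIMSEQ_le_const2[OF lim(1), of "boundary_density x"]
          LIMSEQ_le_const[OF lim(2), of "boundary_density x"] elim x by force
    qed
  qed
  then show ?thesis by (rule that)
qed

text \<open>Where \<open>r\<close> is \<open>0\<close> or \<open>R\<close>, one of the two
  displacements is blocked, and a two-sided direction needs both.\<close>

lemma boundary_direction_vanishes:
  "two_sided h e \<Longrightarrow> (\<theta>, \<phi>) \<in> hemisphere \<Longrightarrow> \<not> free (\<theta>, \<phi>) \<Longrightarrow> h \<theta> \<phi> = 0"
proof -
  assume h: "two_sided h e" and x: "(\<theta>, \<phi>) \<in> hemisphere" and nf: "\<not> free (\<theta>, \<phi>)"
  have "e * \<bar>h \<theta> \<phi>\<bar> \<le> 0"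
  proof -
    have "r \<theta> \<phi> \<le> 0 \<or> R \<theta> \<phi> \<le> r \<theta> \<phi>" using nf x by (simp add: free_def not_less)
    then show ?thesis using two_sided_bounds[OF h x] by linarith
  qed
  then show "h \<theta> \<phi> = 0" using h by (simp add: two_sided_def mult_le_0_iff)
qed

text \<open>This is the degenerate case with no patch to trade on: every two-sided direction then
  vanishes almost everywhere on the hemisphere, so the zone does not move up to a null set.\<close>

lemma free_null_stationary:
  assumes null: "AE x in lborel. \<not> free x" and h: "two_sided h e" and \<epsilon>: "\<bar>\<epsilon>\<bar> \<le> e"
  shows "interference (perturb h \<epsilon>) = interference r" "volume (perturb h \<epsilon>) = volume r"
proof -
  have ad: "admissible R (perturb h \<epsilon>)" by (rule admissible_perturb[OF h \<epsilon>])
  have eq: "AE x in lborel. shell K (perturb h \<epsilon>) x = shell K r x" for K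
    using null
  proof eventually_elim
    case (elim x)
    show ?case
      using boundary_direction_vanishes[OF h, of "fst x" "snd x"] elim
      by (cases "x \<in> hemisphere") (simp_all add: shell_def perturb_def)
  qed
  show "interference (perturb h \<epsilon>) = interference r"
    unfolding interference_eq(1)[OF ad] interference_eq(1)[OF admissible_r]
    by (intro integral_cong_AE eq borel_measurable_integrable interference_eq(2) ad admissible_r)
  show "volume (perturb h \<epsilon>) = volume r"
    unfolding volume_eq(1)[OF ad] volume_eq(1)[OF admissible_r]
    by (intro integral_cong_AE eq borel_measurable_integrable volume_eq(2) ad admissible_r)
qed

subsection \<open>Stationarity of the Lagrangian\<close>

text \<open>The integrand may be unbounded, so the Lagrangian cannot be differentiated under the
  integral sign. Instead, a direction along which it grows is corrected by a bump on a patch where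
  the density is uniformly close to \<open>\<mu>\<close>: the bump makes the volume decrease to first order and
  costs almost exactly \<open>\<mu>\<close> units of interference per unit of volume.\<close>

lemma lagrangian_derivative_nonpos:
  assumes const: "AE x in lborel. free x \<longrightarrow> boundary_density x = \<mu>"
    and nonnull: "\<not> (AE x in lborel. \<not> free x)"
    and h: "two_sided h e"
    and D: "((\<lambda>\<epsilon>. interference (perturb h \<epsilon>) - a - \<mu> * volume (perturb h \<epsilon>)) has_real_derivative D) (at 0)"
  shows "D \<le> 0"
proof (rule ccontr)
  assume "\<not> D \<le> 0"
  then have Dpos: "0 < D" by simp
  \<comment> \<open>The corrected direction is to have flux \<open>- \<kappa>\<close>, which costs
    at most \<open>\<mu> * \<kappa> \<le> D / 2\<close> of interference rate. The tolerance
    \<open>\<eta>\<close> around \<open>\<mu>\<close> costs at most another \<open>D / 4\<close> for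
    the volume rate \<open>\<bar>\<kappa> + flux h\<bar>\<close> moved by the bump. At least
    \<open>D / 4 > 0\<close> remains.\<close>
  define \<kappa> where "\<kappa> = D / (2 * (\<bar>\<mu>\<bar> + 1))"
  define \<eta> where "\<eta> = D / (4 * (\<bar>\<kappa> + flux h\<bar> + 1))"
  have \<kappa>: "0 < \<kappa>" using Dpos by (simp add: \<kappa>_def add_nonneg_pos)
  have \<eta>: "0 < \<eta>" unfolding \<eta>_def using Dpos by (intro divide_pos_pos mult_pos_pos) linarith+
  have cancel: "0 < t \<Longrightarrow> t * (D / (n * t)) = D / n" for t n by simp
  have "\<mu> * \<kappa> \<le> (\<bar>\<mu>\<bar> + 1) * \<kappa>" using \<kappa> by (intro mult_right_mono) auto
  also have "\<dots> = D / 2"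
    using cancel[of "\<bar>\<mu>\<bar> + 1" 2] by (simp only: \<kappa>_def add_nonneg_pos abs_ge_zero zero_less_one)
  finally have \<mu>\<kappa>: "\<mu> * \<kappa> \<le> D / 2" .
  have "\<eta> * \<bar>\<kappa> + flux h\<bar> \<le> \<eta> * (\<bar>\<kappa> + flux h\<bar> + 1)" using \<eta> by (intro mult_left_mono) auto
  also have "\<dots> = D / 4"
    using cancel[of "\<bar>\<kappa> + flux h\<bar> + 1" 4]
    by (simp only: \<eta>_def mult.commute add_nonneg_pos abs_ge_zero zero_less_one)
  finally have \<eta>\<kappa>: "\<eta> * \<bar>\<kappa> + flux h\<bar> \<le> D / 4" .
  have near: "\<not> (AE x in lborel. free x \<longrightarrow> boundary_density x \<notin> {\<mu> - \<eta><..<\<mu> + \<eta>})"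
  proof
    assume "AE x in lborel. free x \<longrightarrow> boundary_density x \<notin> {\<mu> - \<eta><..<\<mu> + \<eta>}"
    with const have "AE x in lborel. \<not> free x" by eventually_elim (use \<eta> in auto)
    with nonnull show False by simp
  qed
  obtain A \<delta> N where A: "patch A \<delta> N"
    and fA: "\<And>\<theta> \<phi> \<rho>. (\<theta>, \<phi>) \<in> A \<Longrightarrow> \<bar>\<rho> - r \<theta> \<phi>\<bar> \<le> \<delta> \<Longrightarrow> f \<theta> \<phi> \<rho> \<in> {\<mu> - \<eta>..\<mu> + \<eta>}"
    by (rule patch_exists[OF _ _ _ near, of "{\<mu> - \<eta>..\<mu> + \<eta>}"]) auto
  define M where "M = flux (bump (\<lambda>\<theta> \<phi>. 0) 1 A)"
  have M: "0 < M" using flux_patch_pos[OF A] by (simp add: M_def)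
  define c where "c = (- \<kappa> - flux h) / M"
  \<comment> \<open>\<open>m\<close> is the unfavourable end of the density range on the patch: the
    lower end if the bump advances, the upper end if it recedes.\<close>
  define m where "m = (if 0 \<le> c then \<mu> - \<eta> else \<mu> + \<eta>)"
  define h' where "h' = bump h c A"
  obtain e' where h': "two_sided h' e'" using two_sided_bump_exists[OF A h] unfolding h'_def by blast
  have "flux h' = flux h + c * M"
    unfolding h'_def M_def by (rule flux_bump[OF A h])
  then have fl: "flux h' = - \<kappa>" using M by (simp add: c_def)
  define L where "L = (\<lambda>\<epsilon>. interference (perturb h \<epsilon>) - a - \<mu> * volume (perturb h \<epsilon>))"
  \<comment> \<open>The first two terms together are the exact change of interference along
    \<open>h\<close>; it is differentiable here because the Lagrangian is so by assumption and the
    volume always is. Only the bump is estimated.\<close>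
  define W where "W = (\<lambda>\<epsilon>. (L \<epsilon> - L 0) + \<mu> * (volume (perturb h \<epsilon>) - volume r)
    + m * (volume (perturb h' \<epsilon>) - volume (perturb h \<epsilon>)))"
  have DL: "(L has_real_derivative D) (at 0)" using D by (simp add: L_def)
  have "(W has_real_derivative D + \<mu> * flux h + m * (flux h' - flux h)) (at 0)"
    unfolding W_def
    by (auto intro!: derivative_eq_intros DL volume_perturb_deriv[OF h] volume_perturb_deriv[OF h'])
  moreover have "\<forall>\<^sub>F \<epsilon> in at_right 0. W \<epsilon> \<le> interference (perturb h' \<epsilon>) - interference r"
  proof -
    have "\<forall>\<^sub>F \<epsilon> in at_right 0. m * (volume (perturb h' \<epsilon>) - volume (perturb h \<epsilon>))
        \<le> interference (perturb h' \<epsilon>) - interference (perturb h \<epsilon>)"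
      unfolding h'_def
    proof (rule bump_gain[OF A h])
      show "(0 < c \<longrightarrow> m \<le> f \<theta> \<phi> \<rho>) \<and> (c < 0 \<longrightarrow> f \<theta> \<phi> \<rho> \<le> m)"
        if "(\<theta>, \<phi>) \<in> A" "\<bar>\<rho> - r \<theta> \<phi>\<bar> \<le> \<delta>" for \<theta> \<phi> \<rho>
        using fA[OF that] by (auto simp: m_def)
    qed
    then show ?thesis by eventually_elim (simp add: W_def L_def algebra_simps)
  qed
  moreover have "flux h' < 0" using fl \<kappa> by simp
  moreover have "W 0 = 0" by (simp add: W_def)
  ultimately have "D + \<mu> * flux h + m * (flux h' - flux h) \<le> 0"
    using no_descent[OF h'] by blast
  moreover have "m * (flux h' - flux h) = - \<mu> * (\<kappa> + flux h) - \<eta> * \<bar>\<kappa> + flux h\<bar>"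
  proof -
    have "0 \<le> c \<longleftrightarrow> \<kappa> + flux h \<le> 0" using M by (auto simp: c_def field_simps)
    then show ?thesis
      by (cases "0 \<le> c") (simp_all add: m_def fl abs_of_nonpos abs_of_pos algebra_simps)
  qed
  ultimately show False using \<mu>\<kappa> \<eta>\<kappa> Dpos by (simp add: algebra_simps)
qed

text \<open>A two-sided direction can be reversed, which turns \<open>D\<close> into
  \<open>- D\<close>, so the one-sided bound applies twice. If the free points are null, the
  Lagrangian is constant along \<open>h\<close>.\<close>

lemma lagrangian_derivative_zero:
  assumes const: "AE x in lborel. free x \<longrightarrow> boundary_density x = \<mu>"
    and h: "two_sided h e"
    and D: "((\<lambda>\<epsilon>. interference (perturb h \<epsilon>) - a - \<mu> * volume (perturb h \<epsilon>)) has_real_derivative D) (at 0)"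
  shows "D = 0"
proof (cases "AE x in lborel. \<not> free x")
  case True
  have "((\<lambda>\<epsilon>. interference r - a - \<mu> * volume r) has_real_derivative D) (at 0)"
    using D
    by (rule has_field_derivative_transform_within[of _ _ _ _ e])
      (use free_null_stationary[OF True h] h in \<open>auto simp: two_sided_def dist_real_def\<close>)
  then show ?thesis using DERIV_unique DERIV_const by blast
next
  case False
  have neg: "perturb (\<lambda>\<theta> \<phi>. - h \<theta> \<phi>) \<epsilon> = perturb h (- \<epsilon>)" for \<epsilon> by (simp add: perturb_def)
  have "two_sided (\<lambda>\<theta> \<phi>. - h \<theta> \<phi>) e" using h by (simp add: two_sided_def neg)
  moreover have "((\<lambda>\<epsilon>. interference (perturb (\<lambda>\<theta> \<phi>. - h \<theta> \<phi>) \<epsilon>) - a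
      - \<mu> * volume (perturb (\<lambda>\<theta> \<phi>. - h \<theta> \<phi>) \<epsilon>)) has_real_derivative - D) (at 0)"
    unfolding neg using DERIV_mirror[of _ D 0] D by simp
  ultimately have "- D \<le> 0" using lagrangian_derivative_nonpos[OF const False] by blast
  moreover have "D \<le> 0" using lagrangian_derivative_nonpos[OF const False h D] .
  ultimately show ?thesis by simp
qed

end

section \<open>From the physical data to the density\<close>

lemma borel_measurable_region_density:
  assumes lam_meas: "set_borel_measurable borel (region R) (\<lambda>(\<theta>, \<phi>, \<rho>). lam \<theta> \<phi> \<rho>)"
    and l_cont: "continuous_on {0<..} l"
    and g_meas: "set_borel_measurable borel hemisphere (\<lambda>(\<theta>, \<phi>). g \<theta> \<phi>)"
  shows "set_borel_measurable borel (region R) (\<lambda>(\<theta>, \<phi>, \<rho>). P * lam \<theta> \<phi> \<rho> * l \<rho> * g \<theta> \<phi> :: real)"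
proof -
  define lam0 where "lam0 = (\<lambda>z. indicator (region R) z *\<^sub>R (case z of (\<theta>, \<phi>, \<rho>) \<Rightarrow> lam \<theta> \<phi> \<rho>))"
  define g0 where "g0 = (\<lambda>x. indicator hemisphere x *\<^sub>R (case x of (\<theta>, \<phi>) \<Rightarrow> g \<theta> \<phi>))"
  \<comment> \<open>\<open>l\<close> is continuous at positive radii only, while
    \<open>region R\<close> also contains radius \<open>0\<close>; the value there is restored as a
    single point.\<close>
  define l0 where "l0 = (\<lambda>\<rho>. indicator {0<..} \<rho> *\<^sub>R l \<rho> + indicator {0} \<rho> * l 0)"
  have "(\<lambda>\<rho>. indicator {0<..} \<rho> *\<^sub>R l \<rho>) \<in> borel_measurable borel"
    using l_cont by (intro borel_measurable_continuous_on_indicator) auto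
  then have [measurable]: "l0 \<in> borel_measurable borel" unfolding l0_def by measurable
  have [measurable]: "lam0 \<in> borel_measurable borel" "g0 \<in> borel_measurable borel"
    using lam_meas g_meas by (simp_all add: lam0_def g0_def set_borel_measurable_def)
  have [measurable]: "(\<lambda>z::real \<times> real \<times> real. (fst z, fst (snd z))) \<in> borel \<rightarrow>\<^sub>M borel"
    "(\<lambda>z::real \<times> real \<times> real. snd (snd z)) \<in> borel \<rightarrow>\<^sub>M borel"
    by (intro borel_measurable_continuous_onI continuous_intros)+
  have "(\<lambda>z. P * lam0 z * l0 (snd (snd z)) * g0 (fst z, fst (snd z))) \<in> borel_measurable borel"
    by measurable
  moreover have "(\<lambda>z. P * lam0 z * l0 (snd (snd z)) * g0 (fst z, fst (snd z)))
     = (\<lambda>z. indicator (region R) z *\<^sub>R (case z of (\<theta>, \<phi>, \<rho>) \<Rightarrow> P * lam \<theta> \<phi> \<rho> * l \<rho> * g \<theta> \<phi>))"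
    by (auto simp: fun_eq_iff lam0_def g0_def l0_def indicator_def region_def)
  ultimately show ?thesis by (simp add: set_borel_measurable_def)
qed

theorem theorem1:
  fixes P a' :: real
    and lam :: "real \<Rightarrow> real \<Rightarrow> real \<Rightarrow> real"
    and l :: "real \<Rightarrow> real"
    and g R rstar :: "real \<Rightarrow> real \<Rightarrow> real"
  assumes P_pos: "P > 0"
    and lam_nonneg: "\<And>\<theta> \<phi> \<rho>. (\<theta>, \<phi>, \<rho>) \<in> region R \<Longrightarrow> lam \<theta> \<phi> \<rho> \<ge> 0"
    and lam_meas: "set_borel_measurable borel (region R) (\<lambda>(\<theta>, \<phi>, \<rho>). lam \<theta> \<phi> \<rho>)"
    and lam_cont: "\<And>\<theta> \<phi>. (\<theta>, \<phi>) \<in> hemisphere \<Longrightarrow> continuous_on {0<..<R \<theta> \<phi>} (lam \<theta> \<phi>)"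
    and l_nonneg: "\<And>\<rho>. \<rho> \<ge> 0 \<Longrightarrow> l \<rho> \<ge> 0"
    and l_cont: "continuous_on {0<..} l"
    and g_nonneg: "\<And>\<theta> \<phi>. (\<theta>, \<phi>) \<in> hemisphere \<Longrightarrow> g \<theta> \<phi> \<ge> 0"
    and g_meas: "set_borel_measurable borel hemisphere (\<lambda>(\<theta>, \<phi>). g \<theta> \<phi>)"
    and R_nonneg: "\<And>\<theta> \<phi>. (\<theta>, \<phi>) \<in> hemisphere \<Longrightarrow> R \<theta> \<phi> \<ge> 0"
    and R_meas: "set_borel_measurable borel hemisphere (\<lambda>(\<theta>, \<phi>). R \<theta> \<phi>)"
    and finite_volume:
      "set_integrable lborel (region R) (\<lambda>(\<theta>, \<phi>, \<rho>). \<rho>\<^sup>2 * sin \<theta>)"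
    and finite_interference:
      "set_integrable lborel (region R)
         (\<lambda>(\<theta>, \<phi>, \<rho>). P * lam \<theta> \<phi> \<rho> * l \<rho> * g \<theta> \<phi> * \<rho>\<^sup>2 * sin \<theta>)"
    and minimizer:
      "min_volume_solution P lam l g R (expected_interference P lam l g R - a') rstar"
  shows "\<exists>\<mu>::real.
           lagrange_multiplier P lam l g R (expected_interference P lam l g R - a') rstar \<mu> \<and>
           (AE (\<theta>, \<phi>) in lborel. (\<theta>, \<phi>) \<in> hemisphere \<longrightarrow>
              0 < rstar \<theta> \<phi> \<longrightarrow> rstar \<theta> \<phi> < R \<theta> \<phi> \<longrightarrow>
              P * lam \<theta> \<phi> (rstar \<theta> \<phi>) * l (rstar \<theta> \<phi>) * g \<theta> \<phi> = \<mu>)"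
proof -
  define a where "a = expected_interference P lam l g R - a'"
  interpret z: no_fly_zone "\<lambda>\<theta> \<phi> \<rho>. P * lam \<theta> \<phi> \<rho> * l \<rho> * g \<theta> \<phi>" R
  proof unfold_locales
    show "set_borel_measurable borel (region R) (\<lambda>(\<theta>, \<phi>, \<rho>). P * lam \<theta> \<phi> \<rho> * l \<rho> * g \<theta> \<phi>)"
      using lam_meas l_cont g_meas by (rule borel_measurable_region_density)
    show "0 \<le> P * lam \<theta> \<phi> \<rho> * l \<rho> * g \<theta> \<phi>" if "(\<theta>, \<phi>, \<rho>) \<in> region R" for \<theta> \<phi> \<rho>
      using lam_nonneg[OF that] that P_pos l_nonneg g_nonneg by (simp add: region_def)
    show "continuous_on {0<..<R \<theta> \<phi>} (\<lambda>\<rho>. P * lam \<theta> \<phi> \<rho> * l \<rho> * g \<theta> \<phi>)"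
      if "(\<theta>, \<phi>) \<in> hemisphere" for \<theta> \<phi>
    proof -
      have "continuous_on {0<..<R \<theta> \<phi>} l" by (rule continuous_on_subset[OF l_cont]) auto
      then show ?thesis by (intro continuous_intros lam_cont[OF that])
    qed
  qed (use R_nonneg R_meas finite_volume finite_interference in auto)
  have E: "z.interference s = expected_interference P lam l g s" for s
    by (simp add: z.interference_def expected_interference_def)
  interpret z: minimal_no_fly_zone "\<lambda>\<theta> \<phi> \<rho>. P * lam \<theta> \<phi> \<rho> * l \<rho> * g \<theta> \<phi>" R rstar a
    using minimizer by unfold_locales (simp add: min_volume_solution_def E a_def)
  \<comment> \<open>One constant serves both claims: the almost everywhere value of the density at
    the free boundary is also the multiplier that makes the Lagrangian stationary. No rate of the
    constraint has to be inverted to find it.\<close>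
  obtain \<mu> where \<mu>: "AE x in lborel. z.free x \<longrightarrow> z.boundary_density x = \<mu>"
    using z.boundary_density_constant by blast
  have "lagrange_multiplier P lam l g R a rstar \<mu>"
    unfolding lagrange_multiplier_def
  proof (intro allI impI)
    fix h D
    assume adm: "\<forall>\<^sub>F \<epsilon> in at 0. admissible R (\<lambda>\<theta> \<phi>. rstar \<theta> \<phi> + \<epsilon> * h \<theta> \<phi>)"
      and D: "((\<lambda>\<epsilon>. lagrangian P lam l g a \<mu> (\<lambda>\<theta> \<phi>. rstar \<theta> \<phi> + \<epsilon> * h \<theta> \<phi>)) has_real_derivative D) (at 0)"
    obtain d where "0 < d" and d: "\<And>\<epsilon>. \<epsilon> \<noteq> 0 \<Longrightarrow> \<bar>\<epsilon>\<bar> < d \<Longrightarrow> admissible R (z.perturb h \<epsilon>)"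
      using adm by (auto simp: eventually_at dist_real_def z.perturb_def)
    \<comment> \<open>Admissibility is known for nonzero \<open>\<epsilon>\<close> strictly within
      \<open>d\<close>; halving puts both ends there.\<close>
    then have "z.two_sided h (d / 2)" by (simp add: z.two_sided_def)
    then show "D = 0"
      using z.lagrangian_derivative_zero[OF \<mu>, of h "d / 2" D] D
      by (simp add: lagrangian_def E z.perturb_def)
  qed
  moreover have "AE (\<theta>, \<phi>) in lborel. (\<theta>, \<phi>) \<in> hemisphere \<longrightarrow>
              0 < rstar \<theta> \<phi> \<longrightarrow> rstar \<theta> \<phi> < R \<theta> \<phi> \<longrightarrow>
              P * lam \<theta> \<phi> (rstar \<theta> \<phi>) * l (rstar \<theta> \<phi>) * g \<theta> \<phi> = \<mu>"
    using \<mu> by eventually_elim (auto simp: z.free_def z.boundary_density_def)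
  ultimately show ?thesis unfolding a_def by blast
qed

end
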